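(* Let $\mathbb{P}$ be a Borel probability measure on $\mathbb{H}_+(d)$ and let $S\sim\mathbb{P}$. Assume $\mathbb{P}(\mathbb{H}_{++}(d))>0$ and $\mathbb{E}\operatorname{tr}S<+\infty$. Let $\mathbb{A}=Q_0+\mathbb{M}$ be an affine subspace of $\mathbb{H}(d)$ ($Q_0\in\mathbb{H}(d)$, $\mathbb{M}\subseteq\mathbb{H}(d)$ a real linear subspace) such that $\mathbb{H}_{++}(d)\cap\mathbb{A}\neq\emptyset$. Then there exists a unique barycenter $$Q_*=\operatorname*{argmin}_{Q\in\mathbb{H}_+(d)\cap\mathbb{A}}\ \mathbb{E}\,d_{BW}^2(Q,S),$$ and it is positive definite: $Q_*\succ0$. Moreover, $Q_*$ is characterised as the unique solution of the equation $$\Pi_{\mathbb{M}}\,\mathbb{E}\,T_Q^S=\Pi_{\mathbb{M}}I,\qquad Q\in\mathbb{H}_{++}(d)\cap\mathbb{A}.$$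
   Context: $\mathbb{H}(d)$ is the real vector space of $d\times d$ complex Hermitian matrices with inner product $\langle X,Y\rangle=\operatorname{tr}(XY)$ (Frobenius); $\mathbb{H}_+(d)$ and $\mathbb{H}_{++}(d)$ are its subsets of positive semi-definite and positive definite matrices. $I$ is the identity matrix. For $Q,S\in\mathbb{H}_+(d)$ the Bures-Wasserstein distance is $d_{BW}^2(Q,S)=\operatorname{tr}Q+\operatorname{tr}S-2\operatorname{tr}(Q^{1/2}SQ^{1/2})^{1/2}$. For $Q\in\mathbb{H}_{++}(d)$, $S\in\mathbb{H}_+(d)$, $$T_Q^S=S^{1/2}\bigl(S^{1/2}QS^{1/2}\bigr)^{-1/2}S^{1/2}=Q^{-1/2}\bigl(Q^{1/2}SQ^{1/2}\bigr)^{1/2}Q^{-1/2},$$ where $(S^{1/2}QS^{1/2})^{-1/2}$ denotes the Moore-Penrose pseudo-inverse of $(S^{1/2}QS^{1/2})^{1/2}$. $\Pi_{\mathbb{M}}$ is the orthogonal projector of $\mathbb{H}(d)$ onto $\mathbb{M}$. *)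

theory Defs
  imports "HOL-Probability.Probability"
begin

definition mat_adj :: "complex^'n^'m \<Rightarrow> complex^'m^'n" where
  "mat_adj A = (\<chi> i j. cnj (A $ j $ i))"

definition hermitian_mats :: "(complex^'n^'n) set" where
  "hermitian_mats = {A. mat_adj A = A}"

(* The sesquilinear form x* y; the inner product on the type complex^'n is its real part only. *)
definition cinner_vec :: "complex^'n \<Rightarrow> complex^'n \<Rightarrow> complex" where
  "cinner_vec x y = (\<Sum>i\<in>UNIV. cnj (x $ i) * y $ i)"

(* For Hermitian A the number x* A x is real, so that taking Re loses nothing. *)
definition psd_mats :: "(complex^'n^'n) set" where
  "psd_mats = {A \<in> hermitian_mats. \<forall>x. 0 \<le> Re (cinner_vec x (A *v x))}"

definition pd_mats :: "(complex^'n^'n) set" where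
  "pd_mats = {A \<in> hermitian_mats. \<forall>x. x \<noteq> 0 \<longrightarrow> 0 < Re (cinner_vec x (A *v x))}"

(* The positive semi-definite square root; only meaningful for A in psd_mats. *)
definition mat_sqrt :: "complex^'n^'n \<Rightarrow> complex^'n^'n" where
  "mat_sqrt A = (THE R. R \<in> psd_mats \<and> R ** R = A)"

(* The Moore-Penrose pseudo-inverse, given by the four Penrose equations. *)
definition mat_pinv :: "complex^'n^'n \<Rightarrow> complex^'n^'n" where
  "mat_pinv A = (THE X. A ** X ** A = A \<and> X ** A ** X = X \<and>
     mat_adj (A ** X) = A ** X \<and> mat_adj (X ** A) = X ** A)"

(* The square of the Bures-Wasserstein distance. All traces are real for Q, S in psd_mats. *)
definition bw_dist_sq :: "complex^'n^'n \<Rightarrow> complex^'n^'n \<Rightarrow> real" where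
  "bw_dist_sq Q S = Re (trace Q) + Re (trace S)
     - 2 * Re (trace (mat_sqrt (mat_sqrt Q ** S ** mat_sqrt Q)))"

definition ot_map :: "complex^'n^'n \<Rightarrow> complex^'n^'n \<Rightarrow> complex^'n^'n" where
  "ot_map Q S = mat_sqrt S ** mat_pinv (mat_sqrt (mat_sqrt S ** Q ** mat_sqrt S)) ** mat_sqrt S"

(* Orthogonal projection with respect to the inner product of the type. On matrices this is the
   real Frobenius inner product Re (tr (X* Y)), which restricts to tr (X Y) on Hermitian matrices:
   see inner_hermitian below. *)
definition orth_proj :: "'a::euclidean_space set \<Rightarrow> 'a \<Rightarrow> 'a" where
  "orth_proj M X = (THE Y. Y \<in> M \<and> X - Y \<in> orthogonal_comp M)"

lemma inner_hermitian:
  fixes X Y :: "complex^'n^'n"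
  assumes "X \<in> hermitian_mats" "Y \<in> hermitian_mats"
  shows "complex_of_real (X \<bullet> Y) = trace (X ** Y)"
proof -
  have X: "X $ j $ i = cnj (X $ i $ j)" and Y: "Y $ j $ i = cnj (Y $ i $ j)" for i j
    using assms unfolding hermitian_mats_def mat_adj_def by (auto simp: vec_eq_iff)
  have Y': "Re (Y $ j $ i) = Re (Y $ i $ j)" "Im (Y $ j $ i) = - Im (Y $ i $ j)" for i j
    using Y[of j i] by simp_all
  have re: "Re (trace (X ** Y)) = X \<bullet> Y"
    unfolding trace_def matrix_matrix_mult_def inner_vec_def inner_complex_def
    by (simp, intro sum.cong refl) (metis Y' mult_minus_right diff_minus_eq_add)
  have "cnj (trace (X ** Y)) = (\<Sum>i\<in>UNIV. \<Sum>j\<in>UNIV. X $ j $ i * Y $ i $ j)"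
    by (simp add: trace_def matrix_matrix_mult_def X[symmetric] Y[symmetric])
  also have "\<dots> = trace (X ** Y)"
    by (subst sum.swap) (simp add: trace_def matrix_matrix_mult_def)
  finally have "Im (trace (X ** Y)) = 0"
    by (metis cnj.sel(2) neg_equal_zero)
  with re show ?thesis by (simp add: complex_eq_iff)
qed

end

theory Submission
  imports Defs
begin

text \<open>
  Write \<open>F(Q,S)\<close> for the fidelity \<open>tr \<surd>(\<surd>Q S \<surd>Q)\<close>, so that the squared distance is
  \<open>tr Q + tr S - 2 F(Q,S)\<close>, and \<open>T\<close> for the transport map \<open>T\<^sub>Q\<^sup>S\<close>. Two algebraic facts carry all
  the rest (lemmas \<open>ot_map\<close> and \<open>ot_map_transport\<close>): \<open>F(Q,S) = \<langle>T,Q\<rangle>\<close>, and \<open>T Q T = S\<close> for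
  positive definite \<open>Q\<close>.

  The key is the inequality \<open>2 F(Q',S) \<le> \<langle>T,Q\<rangle> + \<langle>T,Q'\<rangle>\<close>, valid for positive definite \<open>Q\<close> and all
  positive semi-definite \<open>Q'\<close> and \<open>S\<close>, strict if \<open>S\<close> is positive definite and \<open>Q' \<noteq> Q\<close>
  (\<open>fidelity_subgradient\<close>). It says that \<open>T/2\<close> is a supergradient of \<open>F(\<cdot>,S)\<close> at \<open>Q\<close>. Taking
  expectations, \<open>I - \<bbbE> T\<close> is a subgradient at \<open>Q\<close> of the expected cost, and the resulting
  inequality is strict because \<open>S\<close> is positive definite with positive probability
  (\<open>cost_subgradient\<close>). Hence a positive definite \<open>Q\<close> in the affine space for which \<open>I - \<bbbE> T\<close> is
  orthogonal to the direction space is the only minimiser. This gives both uniqueness claims once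
  one such \<open>Q\<close> is found.

  A minimiser \<open>Q\<close> exists since the cost is continuous and coercive (\<open>cost_minimizer_exists\<close>).
  That it is positive definite and solves the equation follows from one variational inequality.
  Let \<open>Q\<^sub>t = Q + t D\<close> be positive definite with \<open>t > 0\<close>. The subgradient inequality based at \<open>Q\<^sub>t\<close>,
  not at \<open>Q\<close>, together with minimality of \<open>Q\<close> gives \<open>\<langle>\<bbbE> T\<^sub>t, D\<rangle> \<le> tr D\<close>, where \<open>T\<^sub>t\<close> is the
  transport map from \<open>Q\<^sub>t\<close>.
  \<^item> If \<open>Q\<close> were singular, take \<open>D = Q\<^sub>1 - Q\<close> with \<open>Q\<^sub>1\<close> positive definite. Then \<open>T\<^sub>t Q\<^sub>t T\<^sub>t = S\<close> forces
    \<open>tr T\<^sub>t\<close> to grow at least like \<open>1/\<surd>t\<close>, uniformly over an event of positive probability, and the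
    left-hand side is unbounded (\<open>ot_map_blows_up\<close>, \<open>minimizer_pd\<close>).
  \<^item> For positive definite \<open>Q\<close>, any direction \<open>D\<close> is allowed, and \<open>t \<rightarrow> 0\<close> for \<open>D\<close> and \<open>- D\<close> gives the
    equation (\<open>minimizer_first_order\<close>).

  The matrix square root and the pseudo-inverse come from a spectral decomposition
  \<open>\<Sum>\<^sub>v \<lambda>\<^sub>v v v\<^sup>*\<close> over a finite orthonormal set of eigenvectors, used only through the functional
  calculus that it induces.
\<close>

section \<open>Matrices with the Frobenius inner product\<close>

text \<open>The matrix product has no ring structure on this type, so that its distributivity, continuity
  and boundedness are all taken from bilinearity.\<close>
interpretation matrix_mult: bounded_bilinear "(**) :: complex^'n^'m \<Rightarrow> complex^'k^'n \<Rightarrow> complex^'k^'m"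
proof (rule bilinear_conv_bounded_bilinear[THEN iffD1])
  show "bilinear ((**) :: complex^'n^'m \<Rightarrow> complex^'k^'n \<Rightarrow> complex^'k^'m)"
    unfolding bilinear_def
    by (auto intro!: linearI simp: matrix_matrix_mult_def vec_eq_iff ring_distribs sum.distrib scaleR_sum_right)
qed

lemma mat_adj_nth [simp]: "mat_adj A $ i $ j = cnj (A $ j $ i)"
  by (simp add: mat_adj_def)

lemma mat_adj_mat_adj [simp]: "mat_adj (mat_adj A) = A"
  by (simp add: vec_eq_iff)

lemma mat_adj_mult: "mat_adj (A ** B) = mat_adj B ** mat_adj A"
  by (simp add: vec_eq_iff matrix_matrix_mult_def mult.commute)

lemma linear_mat_adj: "linear mat_adj"
  by (rule linearI) (simp_all add: vec_eq_iff)

lemmas mat_adj_add = linear_add[OF linear_mat_adj]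
lemmas mat_adj_diff = linear_diff[OF linear_mat_adj]
lemmas mat_adj_scaleR = linear_scale[OF linear_mat_adj]
lemmas mat_adj_zero = linear_0[OF linear_mat_adj]

lemma mat_adj_one [simp]: "mat_adj (mat 1) = mat 1"
  by (simp add: vec_eq_iff mat_def)

lemma inner_matrix_eq: "X \<bullet> Y = Re (trace (mat_adj X ** Y))"
  for X Y :: "complex^'n^'m"
  by (simp add: inner_vec_def trace_def matrix_matrix_mult_def inner_complex_def)
    (rule sum.swap)

lemma inner_matmul_left: "(A ** B) \<bullet> C = B \<bullet> (mat_adj A ** C)"
  for A :: "complex^'n^'m" and B :: "complex^'k^'n"
  by (simp add: inner_matrix_eq mat_adj_mult matrix_mul_assoc)

lemma trace_mult_commute: "trace (A ** B) = trace (B ** A)" for A :: "complex^'n^'m" and B :: "complex^'m^'n"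
  unfolding trace_def matrix_matrix_mult_def
  by (simp add: mult.commute) (rule sum.swap)

lemma inner_matmul_right: "(A ** B) \<bullet> C = A \<bullet> (C ** mat_adj B)"
  for A :: "complex^'n^'m" and B :: "complex^'k^'n"
  by (simp add: inner_matrix_eq mat_adj_mult trace_mult_commute[of "mat_adj B ** mat_adj A"] trace_mult_commute[of "mat_adj A"]
      matrix_mul_assoc)
    (metis matrix_mul_assoc trace_mult_commute)

lemma Re_trace_eq_inner: "Re (trace X) = mat 1 \<bullet> X"
  by (simp add: inner_matrix_eq)

lemma adj_mult_self_eq_0: "mat_adj X ** X = 0 \<Longrightarrow> X = 0"
  for X :: "complex^'n^'m"
  using inner_matrix_eq[of X X] by (simp add: trace_def)

lemma Re_cinner_vec: "Re (cinner_vec x y) = x \<bullet> y"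
  by (simp add: cinner_vec_def inner_vec_def inner_complex_def)

lemma psd_mats_iff: "A \<in> psd_mats \<longleftrightarrow> mat_adj A = A \<and> (\<forall>x. 0 \<le> x \<bullet> (A *v x))"
  by (simp add: psd_mats_def hermitian_mats_def Re_cinner_vec)

lemma pd_mats_iff: "A \<in> pd_mats \<longleftrightarrow> mat_adj A = A \<and> (\<forall>x. x \<noteq> 0 \<longrightarrow> 0 < x \<bullet> (A *v x))"
  by (simp add: pd_mats_def hermitian_mats_def Re_cinner_vec)

lemma cinner_vec_mult: "cinner_vec x (A *v y) = cinner_vec (mat_adj A *v x) y"
  by (simp add: cinner_vec_def matrix_vector_mult_def sum_distrib_left sum_distrib_right mult_ac)
    (rule sum.swap)

lemma inner_matrix_vector: "x \<bullet> (A *v y) = (mat_adj A *v x) \<bullet> y" for A :: "complex^'n^'m"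
  by (metis Re_cinner_vec cinner_vec_mult)

lemma psd_adj: "A \<in> psd_mats \<Longrightarrow> mat_adj A = A" by (simp add: psd_mats_iff)

lemma psd_congruence: "X \<in> psd_mats \<Longrightarrow> mat_adj B ** X ** B \<in> psd_mats"
  unfolding psd_mats_iff
  by (simp add: mat_adj_mult matrix_mul_assoc matrix_vector_mul_assoc[symmetric] inner_matrix_vector[of _ "mat_adj B"])

lemma psd_one: "mat 1 \<in> psd_mats" by (simp add: psd_mats_iff)
lemma psd_zero: "0 \<in> psd_mats" by (simp add: psd_mats_iff mat_adj_zero)

lemma psd_gram: "mat_adj B ** B \<in> psd_mats" for B :: "complex^'n^'n"
  using psd_congruence[OF psd_one, of B] by simp

lemma psd_add: "\<lbrakk>A \<in> psd_mats; B \<in> psd_mats\<rbrakk> \<Longrightarrow> A + B \<in> psd_mats"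
  by (simp add: psd_mats_iff mat_adj_add matrix_vector_mult_add_rdistrib inner_add_right)

lemma scaleR_matvec: "c *\<^sub>R (A *v x) = (c *\<^sub>R A) *v x" for A :: "complex^'n^'m"
  by (simp add: vec_eq_iff matrix_vector_mult_def scaleR_sum_right)

lemma psd_scaleR: "\<lbrakk>0 \<le> c; A \<in> psd_mats\<rbrakk> \<Longrightarrow> c *\<^sub>R A \<in> psd_mats"
  by (simp add: psd_mats_iff mat_adj_scaleR flip: scaleR_matvec)

lemma psd_sum: "(\<And>i. i \<in> I \<Longrightarrow> f i \<in> psd_mats) \<Longrightarrow> sum f I \<in> psd_mats"
  by (induction I rule: infinite_finite_induct) (auto simp: psd_zero psd_add)

lemma closed_psd: "closed (psd_mats :: (complex^'n^'n) set)"
proof -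
  have "psd_mats = {A::complex^'n^'n. mat_adj A = A} \<inter> (\<Inter>x. {A. 0 \<le> x \<bullet> (A *v x)})"
    by (auto simp: psd_mats_iff)
  moreover have "closed {A::complex^'n^'n. mat_adj A = A}"
    by (intro closed_Collect_eq linear_continuous_on continuous_on_id)
       (simp add: linear_conv_bounded_linear[symmetric] linear_mat_adj)
  moreover have "closed {A::complex^'n^'n. 0 \<le> x \<bullet> (A *v x)}" for x
  proof -
    have "linear (\<lambda>A::complex^'n^'n. x \<bullet> (A *v x))"
      by (rule linearI) (simp_all add: matrix_vector_mult_add_rdistrib inner_add_right flip: scaleR_matvec)
    then show ?thesis
      by (intro closed_Collect_le continuous_on_const linear_continuous_on)
        (simp add: linear_conv_bounded_linear)
  qed
  ultimately show ?thesis by (metis (no_types, lifting) closed_INT closed_Int)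
qed

lemma pd_imp_psd: "A \<in> pd_mats \<Longrightarrow> A \<in> psd_mats"
  unfolding psd_mats_iff pd_mats_iff
  by (metis inner_zero_left less_eq_real_def)

section \<open>Spectral decomposition\<close>

definition outer :: "complex^'n \<Rightarrow> complex^'n^'n" where
  "outer v = (\<chi> i j. v $ i * cnj (v $ j))"

definition orthonormal :: "(complex^'n) set \<Rightarrow> bool" where
  "orthonormal V \<longleftrightarrow> (\<forall>v\<in>V. \<forall>w\<in>V. cinner_vec v w = (if v = w then 1 else 0))"

lemma outer_mult: "outer v ** outer w = (\<chi> i j. v $ i * cinner_vec v w * cnj (w $ j))"
  by (simp add: outer_def cinner_vec_def matrix_matrix_mult_def vec_eq_iff sum_distrib_left sum_distrib_right mult_ac)

lemma outer_vec: "outer v *v x = cinner_vec v x *s v"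
  by (simp add: outer_def cinner_vec_def matrix_vector_mult_def vec_eq_iff sum_distrib_left sum_distrib_right mult_ac)

lemma cinner_scale_right: "cinner_vec x (c *s y) = c * cinner_vec x y"
  by (simp add: cinner_vec_def sum_distrib_left mult_ac)

lemma cinner_commute: "cinner_vec x y = cnj (cinner_vec y x)"
  by (simp add: cinner_vec_def mult.commute)

lemma cinner_diff: "cinner_vec x (y - z) = cinner_vec x y - cinner_vec x z"
  by (simp add: cinner_vec_def ring_distribs sum_subtractf)

lemma cinner_add: "cinner_vec x (y + z) = cinner_vec x y + cinner_vec x z"
  by (simp add: cinner_vec_def ring_distribs sum.distrib)

lemma cinner_sum: "cinner_vec x (sum f I) = (\<Sum>i\<in>I. cinner_vec x (f i))"
  by (simp add: cinner_vec_def sum_distrib_left) (rule sum.swap)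

lemma cinner_self: "cinner_vec x x = of_real (x \<bullet> x)"
  using cinner_commute[of x x] Re_cinner_vec[of x x] by (simp add: complex_eq_iff)

lemma psd_outer: "outer v \<in> psd_mats"
proof -
  have "x \<bullet> (outer v *v x) = (cmod (cinner_vec v x))\<^sup>2" for x
    unfolding Re_cinner_vec[symmetric] outer_vec cinner_scale_right
    by (simp add: cinner_commute[of x v] complex_norm_square[symmetric])
  then show ?thesis by (simp add: psd_mats_iff outer_def vec_eq_iff mult.commute)
qed

text \<open>The quadratic form attains its maximum \<open>l\<close> on the unit sphere of \<open>W\<close> at some \<open>v\<close>. The residual
  \<open>u = A v - l v\<close> lies in \<open>W\<close> and is orthogonal to \<open>v\<close>; moving from \<open>v\<close> in the direction \<open>u\<close> would
  increase the form to first order by \<open>2 t \<parallel>u\<parallel>\<^sup>2\<close>, hence \<open>u = 0\<close>.\<close>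
lemma hermitian_eigenvector_on_subspace:
  fixes A :: "complex^'n^'n" and W :: "(complex^'n) set"
  assumes A: "mat_adj A = A" and W: "subspace W" and inv: "\<And>x. x \<in> W \<Longrightarrow> A *v x \<in> W" and ne: "W \<noteq> {0}"
  obtains v l where "v \<in> W" "norm v = 1" "A *v v = l *\<^sub>R v"
proof -
  let ?S = "W \<inter> sphere 0 1"
  from ne W obtain w where w: "w \<in> W" "w \<noteq> 0" by (auto dest: subspace_0)
  have lin: "linear (\<lambda>x. A *v x)" by simp
  have "(1 / norm w) *\<^sub>R w \<in> ?S" using w W by (auto simp: subspace_scale)
  moreover have "compact ?S" using W by (simp add: closed_subspace closed_Int_compact)
  moreover have "continuous_on ?S (\<lambda>x. x \<bullet> (A *v x))"
    by (intro continuous_on_inner continuous_on_id linear_continuous_on)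
      (simp add: linear_conv_bounded_linear[symmetric])
  ultimately obtain v where v: "v \<in> ?S" "\<And>y. y \<in> ?S \<Longrightarrow> y \<bullet> (A *v y) \<le> v \<bullet> (A *v v)"
    using continuous_attains_sup[of ?S "\<lambda>x. x \<bullet> (A *v x)"] by blast
  define l where "l = v \<bullet> (A *v v)"
  define u where "u = A *v v - l *\<^sub>R v"
  have vv: "v \<bullet> v = 1" using v(1) by (simp add: norm_eq_1)
  have uW: "u \<in> W" using v(1) inv W by (auto simp: u_def subspace_diff subspace_scale)
  have uv: "u \<bullet> v = 0" 
    by (simp add: u_def inner_diff_left vv l_def) (simp add: inner_commute)
  have le: "y \<bullet> (A *v y) \<le> l * (y \<bullet> y)" if "y \<in> W" for y
  proof (cases "y = 0")
    case False
    then have "(1 / norm y) *\<^sub>R y \<in> ?S" using that W by (auto simp: subspace_scale)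
    from v(2)[OF this] have "(y \<bullet> (A *v y)) / (norm y)^2 \<le> l"
      by (simp add: linear_scale[OF lin] l_def power2_eq_square)
    then show ?thesis using False by (simp add: divide_simps power2_norm_eq_inner mult.commute split: if_splits)
  qed simp
  have Au: "v \<bullet> (A *v u) = u \<bullet> u"
  proof -
    have "v \<bullet> (A *v u) = (A *v v) \<bullet> u" using inner_matrix_vector[of v A u] A by simp
    also have "\<dots> = (u + l *\<^sub>R v) \<bullet> u" by (simp add: u_def)
    finally show ?thesis using uv by (simp add: inner_add_left inner_commute[of v u])
  qed
  have Av: "u \<bullet> (A *v v) = u \<bullet> u"
  proof -
    have "u \<bullet> (A *v v) = u \<bullet> (u + l *\<^sub>R v)" by (simp add: u_def)
    with uv show ?thesis by (simp only: inner_add_right inner_scaleR_right)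
  qed
  have q: "2 * (u \<bullet> u) \<le> t * (l * (u \<bullet> u) - u \<bullet> (A *v u))" if "t > 0" for t
  proof -
    have "v + t *\<^sub>R u \<in> W" using v(1) uW W by (auto simp: subspace_add subspace_scale)
    have e1: "(v + t *\<^sub>R u) \<bullet> (v + t *\<^sub>R u) = 1 + t\<^sup>2 * (u \<bullet> u)"
      using uv vv by (simp add: inner_add_left inner_add_right inner_commute[of v u] power2_eq_square)
    have e2: "(v + t *\<^sub>R u) \<bullet> (A *v (v + t *\<^sub>R u)) = l + 2 * t * (u \<bullet> u) + t^2 * (u \<bullet> (A *v u))"
      by (simp add: linear_add[OF lin] linear_scale[OF lin] inner_add_left inner_add_right Au Av l_def
          power2_eq_square algebra_simps)
    from le[OF \<open>v + t *\<^sub>R u \<in> W\<close>] have "l + 2 * t * (u \<bullet> u) + t^2 * (u \<bullet> (A *v u)) \<le> l * (1 + t^2 * (u \<bullet> u))"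
      unfolding e1 e2 .
    then have "t * (2 * (u \<bullet> u)) \<le> t * (t * (l * (u \<bullet> u) - u \<bullet> (A *v u)))"
      by (simp add: algebra_simps power2_eq_square)
    then show ?thesis using that by simp
  qed
  have "((\<lambda>t. t * (l * (u \<bullet> u) - u \<bullet> (A *v u))) \<longlongrightarrow> 0 * (l * (u \<bullet> u) - u \<bullet> (A *v u))) (at_right 0)"
    by (intro tendsto_intros)
  moreover have "eventually (\<lambda>t. 2 * (u \<bullet> u) \<le> t * (l * (u \<bullet> u) - u \<bullet> (A *v u))) (at_right 0)"
    using q by (auto simp: eventually_at_filter)
  ultimately have "2 * (u \<bullet> u) \<le> 0 * (l * (u \<bullet> u) - u \<bullet> (A *v u))"
    by (rule tendsto_lowerbound) simp
  then have "u = 0" using inner_ge_zero[of u] inner_eq_zero_iff[of u] by linarith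
  then show thesis using that[of v l] v(1) by (auto simp: u_def)
qed

lemma matvec_sum: "sum f I *v x = (\<Sum>i\<in>I. f i *v x)" for f :: "'i \<Rightarrow> complex^'n^'m"
  by (induction I rule: infinite_finite_induct) (auto simp: matrix_vector_mult_add_rdistrib)

lemma matrix_mult_outer: "A *v v = l *\<^sub>R v \<Longrightarrow> A ** outer v = l *\<^sub>R outer v"
  by (simp add: vec_eq_iff matrix_matrix_mult_def matrix_vector_mult_def outer_def sum_distrib_right
      mult.assoc[symmetric] flip: scaleR_conv_of_real)
    (metis mult_scaleR_left sum_distrib_right)

lemma orthonormal_finite_card:
  fixes V :: "(complex^'n) set"
  assumes "orthonormal V" shows "finite V" "card V \<le> DIM(complex^'n)"
proof -
  have o: "v \<bullet> w = (if v = w then 1 else 0)" if "v \<in> V" "w \<in> V" for v w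
    using assms that unfolding orthonormal_def Re_cinner_vec[symmetric] by auto
  have "pairwise orthogonal V" using o by (auto simp: pairwise_def orthogonal_def)
  moreover have "0 \<notin> V" using o[of 0 0] by auto
  ultimately have "independent V" by (rule pairwise_orthogonal_independent)
  then show "finite V" "card V \<le> DIM(complex^'n)" using independent_bound[of V] by auto
qed

text \<open>An orthonormal set of eigenvectors of maximal size spans: its complex orthogonal complement is
  invariant, and an eigenvector in there could be added to the set.\<close>
theorem spectral_decomposition:
  fixes A :: "complex^'n^'n"
  assumes A: "mat_adj A = A"
  obtains V l where "finite V" "orthonormal V" "(\<Sum>v\<in>V. outer v) = mat 1"
    "A = (\<Sum>v\<in>V. l v *\<^sub>R outer v)"
proof -
  define E where "E = {V. orthonormal V \<and> (\<forall>v\<in>V. \<exists>l::real. A *v v = l *\<^sub>R v)}"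
  have "{} \<in> E" by (simp add: E_def orthonormal_def)
  moreover have "\<forall>V. V \<in> E \<longrightarrow> card V < Suc DIM(complex^'n)"
    using orthonormal_finite_card(2) by (auto simp: E_def less_Suc_eq_le)
  ultimately obtain V where V: "V \<in> E" and max: "\<And>V'. V' \<in> E \<Longrightarrow> card V' \<le> card V"
    using ex_has_greatest_nat[of "\<lambda>V. V \<in> E" "{}" card "Suc DIM(complex^'n)"] by auto
  from V have on: "orthonormal V" by (simp add: E_def)
  then have fin: "finite V" by (rule orthonormal_finite_card)
  from V obtain l where l: "\<And>v. v \<in> V \<Longrightarrow> A *v v = l v *\<^sub>R v" 
    unfolding E_def by (auto simp: Ball_def) metis
  define W where "W = {x. \<forall>v\<in>V. cinner_vec v x = 0}"
  have lin: "cinner_vec v (c *\<^sub>R x) = c *\<^sub>R cinner_vec v x" "cinner_vec (c *\<^sub>R v) x = c *\<^sub>R cinner_vec v x" for v x c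
    by (simp_all add: cinner_vec_def scaleR_sum_right)
  have cv0: "cinner_vec v 0 = 0" for v by (simp add: cinner_vec_def)
  have "subspace W"
    by (auto simp: W_def subspace_def cinner_add lin cv0)
  moreover have "A *v x \<in> W" if "x \<in> W" for x
    using that by (auto simp: W_def cinner_vec_mult A l lin)
  ultimately have W0: "W = {0}"
  proof (rule_tac ccontr)
    assume W: "subspace W" "\<And>x. x \<in> W \<Longrightarrow> A *v x \<in> W" and "W \<noteq> {0}"
    then obtain u k where u: "u \<in> W" "norm u = 1" "A *v u = k *\<^sub>R u"
      using hermitian_eigenvector_on_subspace[OF A] by blast
    have uu: "cinner_vec u u = 1" using u(2) by (simp add: cinner_self flip: power2_norm_eq_inner)
    have vu: "cinner_vec v u = 0" "cinner_vec u v = 0" if "v \<in> V" for v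
      using u(1) that cinner_commute[of u v] by (auto simp: W_def)
    have "u \<notin> V" using vu uu by force
    have "insert u V \<in> E"
      using V u(3) uu vu by (auto simp: E_def orthonormal_def)
    from max[OF this] show False using \<open>u \<notin> V\<close> fin by simp
  qed
  have one: "(\<Sum>v\<in>V. outer v) = mat 1"
  proof -
    have "(\<Sum>v\<in>V. outer v) *v x = x" for x
    proof -
      have "cinner_vec v (\<Sum>w\<in>V. outer w *v x) = (\<Sum>w\<in>V. if w = v then cinner_vec v x else 0)" if "v \<in> V" for v
        unfolding cinner_sum outer_vec cinner_scale_right
        using on that by (intro sum.cong refl) (auto simp: orthonormal_def)
      then have "x - (\<Sum>v\<in>V. outer v *v x) \<in> W"
        using fin by (simp add: W_def cinner_diff)
      then show ?thesis by (simp add: W0 matvec_sum)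
    qed
    then show ?thesis by (simp add: matrix_eq)
  qed
  have "A = A ** (\<Sum>v\<in>V. outer v)" by (simp add: one)
  also have "\<dots> = (\<Sum>v\<in>V. l v *\<^sub>R outer v)"
    unfolding matrix_mult.sum_right by (intro sum.cong refl matrix_mult_outer l)
  finally show thesis using that[OF fin on one] by blast
qed

lemma orthonormal_outer_mult:
  assumes "orthonormal V" "v \<in> V" "w \<in> V"
  shows "outer v ** outer w = (if v = w then outer v else 0)"
  using assms by (auto simp: outer_mult orthonormal_def vec_eq_iff) (simp add: outer_def)

lemma trace_outer: "mat 1 \<bullet> outer v = v \<bullet> v"
proof -
  have "trace (outer v) = cinner_vec v v"
    by (simp add: trace_def outer_def cinner_vec_def mult.commute)
  then show ?thesis using Re_trace_eq_inner[of "outer v"] Re_cinner_vec[of v v] by simp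
qed

text \<open>The map \<open>\<Phi> f = \<Sum>\<^sub>v f(\<lambda>\<^sub>v) v v\<^sup>*\<close> and the set \<open>\<Lambda>\<close> of eigenvalues, with just the properties that
  the applications need, so that eigenvectors do not appear again.\<close>
theorem functional_calculus:
  fixes A :: "complex^'n^'n"
  assumes A: "mat_adj A = A"
  obtains \<Phi> :: "(real \<Rightarrow> real) \<Rightarrow> complex^'n^'n" and \<Lambda> :: "real set" where
    "finite \<Lambda>"
    "\<Phi> (\<lambda>x. x) = A" "\<Phi> (\<lambda>x. 1) = mat 1"
    "\<And>f g. \<Phi> f ** \<Phi> g = \<Phi> (\<lambda>x. f x * g x)"
    "\<And>f g. \<Phi> f - \<Phi> g = \<Phi> (\<lambda>x. f x - g x)"
    "\<And>f c. c *\<^sub>R \<Phi> f = \<Phi> (\<lambda>x. c * f x)"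
    "\<And>f g. (\<And>x. x \<in> \<Lambda> \<Longrightarrow> f x = g x) \<Longrightarrow> \<Phi> f = \<Phi> g"
    "\<And>f. (\<And>x. x \<in> \<Lambda> \<Longrightarrow> 0 \<le> f x) \<Longrightarrow> \<Phi> f \<in> psd_mats"
    "\<And>f. (\<And>x. x \<in> \<Lambda> \<Longrightarrow> 0 \<le> f x) \<Longrightarrow> norm (\<Phi> f) \<le> mat 1 \<bullet> \<Phi> f"
    "\<And>x. x \<in> \<Lambda> \<Longrightarrow> \<exists>v. v \<noteq> 0 \<and> v \<bullet> (A *v v) = x * (v \<bullet> v)"
proof -
  from spectral_decomposition[OF A] obtain V l where
    fin: "finite V" and on: "orthonormal V" and one: "(\<Sum>v\<in>V. outer v) = mat 1"
    and Ae: "A = (\<Sum>v\<in>V. l v *\<^sub>R outer v)" by blast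
  define \<Phi> where "\<Phi> f = (\<Sum>v\<in>V. f (l v) *\<^sub>R outer v)" for f :: "real \<Rightarrow> real"
  have vv: "v \<bullet> v = 1" if "v \<in> V" for v
    using that on by (simp add: orthonormal_def flip: Re_cinner_vec)
  have mult: "\<Phi> f ** \<Phi> g = \<Phi> (\<lambda>x. f x * g x)" for f g
  proof -
    have "\<Phi> f ** \<Phi> g = (\<Sum>v\<in>V. \<Sum>w\<in>V. (f (l v) * g (l w)) *\<^sub>R (outer v ** outer w))"
      by (simp add: \<Phi>_def matrix_mult.sum_left matrix_mult.sum_right matrix_mult.scaleR_left matrix_mult.scaleR_right
          scaleR_sum_right mult.commute) (rule sum.swap)
    also have "\<dots> = (\<Sum>v\<in>V. \<Sum>w\<in>V. if v = w then (f (l v) * g (l v)) *\<^sub>R outer v else 0)"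
      by (intro sum.cong refl) (simp add: orthonormal_outer_mult[OF on])
    finally show ?thesis using fin by (simp add: \<Phi>_def)
  qed
  have nout: "norm (outer v) = 1" if "v \<in> V" for v
  proof -
    have "(norm (outer v))\<^sup>2 = mat 1 \<bullet> (outer v ** outer v)"
      using psd_adj[OF psd_outer, of v] inner_matmul_left[of "outer v" "mat 1" "outer v"]
      by (simp add: power2_norm_eq_inner)
    also have "\<dots> = 1" using that by (simp add: orthonormal_outer_mult[OF on] trace_outer vv)
    finally show ?thesis by (simp add: power2_eq_1_iff) (metis norm_ge_zero not_one_le_zero neg_0_le_iff_le zero_le_one le_minus_one_simps(3))
  qed
  have eig: "\<exists>v. v \<noteq> 0 \<and> v \<bullet> (A *v v) = x * (v \<bullet> v)" if "x \<in> l ` V" for x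
  proof -
    from that obtain v where v: "v \<in> V" "x = l v" by auto
    have "A *v v = (\<Sum>w\<in>V. if w = v then l v *\<^sub>R v else 0)"
      unfolding Ae matvec_sum using v(1) on
      by (intro sum.cong refl) (auto simp: scaleR_matvec[symmetric] outer_vec orthonormal_def)
    then have "A *v v = l v *\<^sub>R v" using fin v by simp
    then show ?thesis using v vv[of v] by (intro exI[of _ v]) auto
  qed
  show thesis
  proof (rule that[of "l ` V" \<Phi>])
    show "norm (\<Phi> f) \<le> mat 1 \<bullet> \<Phi> f" if "\<And>x. x \<in> l ` V \<Longrightarrow> 0 \<le> f x" for f
      unfolding \<Phi>_def inner_sum_right
      by (rule order_trans[OF norm_sum]) (intro sum_mono, use that in \<open>auto simp: nout trace_outer vv\<close>)
  qed (use fin one mult eig in \<open>auto simp: \<Phi>_def Ae[symmetric] scaleR_diff_left sum_subtractf scaleR_sum_right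
      intro!: sum.cong psd_sum psd_scaleR psd_outer\<close>)
qed

section \<open>Square roots, pseudo-inverses and the positive definite cone\<close>

text \<open>Turns an identity between products into a rewrite rule for right-associated words.\<close>
lemma mult_eq_assoc: "A ** B = C \<Longrightarrow> A ** (B ** Z) = C ** Z"
  for A :: "complex^'n^'m" and B :: "complex^'k^'n" and Z :: "complex^'l^'k"
  by (simp add: matrix_mul_assoc)

lemma psd_eigenvalue_nonneg:
  assumes "A \<in> psd_mats" "\<exists>v. v \<noteq> 0 \<and> v \<bullet> (A *v v) = x * (v \<bullet> v)"
  shows "0 \<le> x"
proof -
  from assms obtain v where v: "v \<noteq> 0" "v \<bullet> (A *v v) = x * (v \<bullet> v)" by blast
  have "0 \<le> v \<bullet> (A *v v)" "0 < v \<bullet> v" using assms(1) v(1) by (simp_all add: psd_mats_iff)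
  then show ?thesis by (simp add: v(2) zero_le_mult_iff)
qed

lemma psd_sqrt_exists:
  fixes A :: "complex^'n^'n"
  assumes "A \<in> psd_mats"
  obtains R where "R \<in> psd_mats" "R ** R = A"
proof (rule functional_calculus[OF psd_adj[OF assms]])
  fix \<Phi> :: "(real \<Rightarrow> real) \<Rightarrow> complex^'n^'n" and \<Lambda> :: "real set"
  assume *: "\<Phi> (\<lambda>x. x) = A" "\<And>f g. \<Phi> f ** \<Phi> g = \<Phi> (\<lambda>x. f x * g x)"
    "\<And>f g. (\<And>x. x \<in> \<Lambda> \<Longrightarrow> f x = g x) \<Longrightarrow> \<Phi> f = \<Phi> g"
    "\<And>f. (\<And>x. x \<in> \<Lambda> \<Longrightarrow> 0 \<le> f x) \<Longrightarrow> \<Phi> f \<in> psd_mats"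
    "\<And>x. x \<in> \<Lambda> \<Longrightarrow> \<exists>v. v \<noteq> 0 \<and> v \<bullet> (A *v v) = x * (v \<bullet> v)"
  have nn: "0 \<le> x" if "x \<in> \<Lambda>" for x using psd_eigenvalue_nonneg[OF assms *(5)[OF that]] .
  show thesis
    by (rule that[of "\<Phi> sqrt"]) (use nn in \<open>auto simp: *(2) *(1)[symmetric] intro!: *(3,4)\<close>)
qed

text \<open>With \<open>X = K K\<close> and \<open>K\<close> Hermitian, the inner product is \<open>\<parallel>K B\<parallel>\<^sup>2\<close>.\<close>
lemma psd_inner_mult:
  fixes X B :: "complex^'n^'n"
  assumes "X \<in> psd_mats"
  shows "0 \<le> B \<bullet> (X ** B)" "B \<bullet> (X ** B) = 0 \<Longrightarrow> X ** B = 0"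
proof -
  obtain K where K: "K \<in> psd_mats" "K ** K = X" using psd_sqrt_exists[OF assms] by blast
  have e: "B \<bullet> (X ** B) = (K ** B) \<bullet> (K ** B)"
    using psd_adj[OF K(1)] by (simp add: inner_matmul_left K(2)[symmetric] matrix_mul_assoc)
  show "0 \<le> B \<bullet> (X ** B)" by (simp add: e)
  show "X ** B = 0" if "B \<bullet> (X ** B) = 0"
    using that unfolding e by (simp add: K(2)[symmetric] flip: matrix_mul_assoc)
qed

lemma psd_inner_mult_right:
  fixes X B :: "complex^'n^'n"
  assumes "X \<in> psd_mats"
  shows "0 \<le> B \<bullet> (B ** X)" "B \<bullet> (B ** X) = 0 \<Longrightarrow> B ** X = 0"
proof -
  obtain K where K: "K \<in> psd_mats" "K ** K = X" using psd_sqrt_exists[OF assms] by blast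
  have e: "B \<bullet> (B ** X) = (B ** K) \<bullet> (B ** K)"
    using psd_adj[OF K(1)] by (simp add: inner_matmul_right K(2)[symmetric] matrix_mul_assoc)
  show "0 \<le> B \<bullet> (B ** X)" by (simp add: e)
  show "B ** X = 0" if "B \<bullet> (B ** X) = 0"
    using that unfolding e by (simp add: K(2)[symmetric] matrix_mul_assoc)
qed

text \<open>For \<open>D = R - R'\<close> equality of the squares gives \<open>R D + D R' = 0\<close>. Pairing with \<open>D\<close> splits this into
  two nonnegative terms that cancel, so both vanish; then \<open>R D = D R' = 0\<close> and \<open>D\<^sup>2 = 0\<close>.\<close>
lemma psd_sqrt_unique:
  fixes R R' :: "complex^'n^'n"
  assumes R: "R \<in> psd_mats" "R' \<in> psd_mats" and eq: "R ** R = R' ** R'"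
  shows "R = R'"
proof -
  let ?D = "R - R'"
  have "R ** ?D + ?D ** R' = 0"
    by (simp add: matrix_mult.diff_left matrix_mult.diff_right eq)
  then have "?D \<bullet> (R ** ?D) + ?D \<bullet> (?D ** R') = 0" by (metis inner_add_right inner_zero_right)
  then have "?D \<bullet> (R ** ?D) = 0" "?D \<bullet> (?D ** R') = 0"
    using psd_inner_mult(1)[OF R(1), of ?D] psd_inner_mult_right(1)[OF R(2), of ?D] by linarith+
  then have z: "R ** ?D = 0" "?D ** R' = 0" using psd_inner_mult(2)[OF R(1)] psd_inner_mult_right(2)[OF R(2)] by blast+
  have aD: "mat_adj ?D = ?D" using R by (simp add: mat_adj_diff psd_adj)
  have "?D ** R = mat_adj (R ** ?D)" unfolding mat_adj_mult aD using R by (simp add: psd_adj)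
  also have "\<dots> = 0" unfolding z by (simp add: mat_adj_zero)
  finally have "mat_adj ?D ** ?D = 0" unfolding aD using z(2)
    by (simp add: matrix_mult.diff_right[of "?D"])
  then have "?D = 0" by (rule adj_mult_self_eq_0)
  then show ?thesis by simp
qed

lemma mat_sqrt_eqI: "\<lbrakk>R \<in> psd_mats; R ** R = A\<rbrakk> \<Longrightarrow> mat_sqrt A = R"
  unfolding mat_sqrt_def by (rule the_equality) (auto intro: psd_sqrt_unique)

lemma mat_sqrt:
  assumes "A \<in> psd_mats"
  shows mat_sqrt_psd: "mat_sqrt A \<in> psd_mats" and mat_sqrt_square: "mat_sqrt A ** mat_sqrt A = A"
  using psd_sqrt_exists[OF assms] mat_sqrt_eqI by metis+

lemma mat_sqrt_adj: "A \<in> psd_mats \<Longrightarrow> mat_adj (mat_sqrt A) = mat_sqrt A"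
  by (simp add: mat_sqrt_psd psd_adj)

lemma psd_inner_nonneg:
  fixes X Y :: "complex^'n^'n"
  assumes "X \<in> psd_mats" "Y \<in> psd_mats"
  shows "0 \<le> X \<bullet> Y"
proof -
  have "X \<bullet> Y = mat_sqrt X \<bullet> (Y ** mat_sqrt X)"
    using inner_matmul_right[of "mat_sqrt X" "mat_sqrt X" Y] assms
    by (simp add: mat_sqrt_square mat_sqrt_adj)
  then show ?thesis using psd_inner_mult(1)[OF assms(2)] by simp
qed

lemma psd_congruence_hermitian:
  "\<lbrakk>X \<in> psd_mats; mat_adj B = B\<rbrakk> \<Longrightarrow> B ** X ** B \<in> psd_mats"
  using psd_congruence[of X B] by simp

lemma psd_norm_le_trace:
  fixes A :: "complex^'n^'n"
  assumes "A \<in> psd_mats" shows "norm A \<le> mat 1 \<bullet> A"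
proof (rule functional_calculus[OF psd_adj[OF assms]])
  fix \<Phi> :: "(real \<Rightarrow> real) \<Rightarrow> complex^'n^'n" and \<Lambda> :: "real set"
  assume *: "\<Phi> (\<lambda>x. x) = A" "\<And>f. (\<And>x. x \<in> \<Lambda> \<Longrightarrow> 0 \<le> f x) \<Longrightarrow> norm (\<Phi> f) \<le> mat 1 \<bullet> \<Phi> f"
    "\<And>x. x \<in> \<Lambda> \<Longrightarrow> \<exists>v. v \<noteq> 0 \<and> v \<bullet> (A *v v) = x * (v \<bullet> v)"
  show ?thesis using *(2)[of "\<lambda>x. x"] psd_eigenvalue_nonneg[OF assms *(3)] by (simp add: *(1))
qed

text \<open>The Penrose equations determine the two projections \<open>A X\<close> and \<open>X A\<close>, and these determine
  \<open>X = X A X\<close>.\<close>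
lemma mat_pinv_eqI:
  fixes A X :: "complex^'n^'n"
  assumes X: "A ** X ** A = A" "X ** A ** X = X" "mat_adj (A ** X) = A ** X" "mat_adj (X ** A) = X ** A"
  shows "mat_pinv A = X"
  unfolding mat_pinv_def
proof (rule the_equality)
  fix Y assume Y: "A ** Y ** A = A \<and> Y ** A ** Y = Y \<and> mat_adj (A ** Y) = A ** Y \<and> mat_adj (Y ** A) = Y ** A"
  have "A ** X = (A ** Y) ** (A ** X)" using Y by (simp add: matrix_mul_assoc)
  also have "\<dots> = mat_adj ((A ** X) ** (A ** Y))" by (simp only: mat_adj_mult[of "A ** X" "A ** Y"] X Y)
  also have "\<dots> = A ** Y" using X Y by (simp add: matrix_mul_assoc)
  finally have 1: "A ** X = A ** Y" .
  have "X ** A = (X ** A) ** (Y ** A)" using Y by (simp add: matrix_mul_assoc[symmetric])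
  also have "\<dots> = mat_adj ((Y ** A) ** (X ** A))" by (simp only: mat_adj_mult[of "Y ** A" "X ** A"] X Y)
  also have "\<dots> = Y ** A" using X Y by (simp add: matrix_mul_assoc[symmetric])
  finally have 2: "X ** A = Y ** A" .
  have "Y = (Y ** A) ** Y" using Y by simp
  also have "\<dots> = X ** (A ** Y)" by (simp only: 2[symmetric] matrix_mul_assoc)
  also have "\<dots> = X" by (simp add: 1[symmetric] matrix_mul_assoc X)
  finally show "Y = X" .
qed (use X in auto)

lemma mat_pinv:
  fixes A :: "complex^'n^'n"
  assumes "A \<in> psd_mats"
  shows mat_pinv_psd: "mat_pinv A \<in> psd_mats"
    and mat_pinv_commute: "mat_pinv A ** A = A ** mat_pinv A"
    and mat_pinv_1: "A ** (A ** mat_pinv A) = A"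
    and mat_pinv_2: "A ** (mat_pinv A ** mat_pinv A) = mat_pinv A"
proof -
  have "mat_pinv A \<in> psd_mats \<and> mat_pinv A ** A = A ** mat_pinv A \<and>
     A ** (A ** mat_pinv A) = A \<and> A ** (mat_pinv A ** mat_pinv A) = mat_pinv A"
  proof (rule functional_calculus[OF psd_adj[OF assms]])
    fix \<Phi> :: "(real \<Rightarrow> real) \<Rightarrow> complex^'n^'n" and \<Lambda> :: "real set"
    assume *: "\<Phi> (\<lambda>x. x) = A" "\<And>f g. \<Phi> f ** \<Phi> g = \<Phi> (\<lambda>x. f x * g x)"
      "\<And>f g. (\<And>x. x \<in> \<Lambda> \<Longrightarrow> f x = g x) \<Longrightarrow> \<Phi> f = \<Phi> g"
      "\<And>f. (\<And>x. x \<in> \<Lambda> \<Longrightarrow> 0 \<le> f x) \<Longrightarrow> \<Phi> f \<in> psd_mats"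
      "\<And>x. x \<in> \<Lambda> \<Longrightarrow> \<exists>v. v \<noteq> 0 \<and> v \<bullet> (A *v v) = x * (v \<bullet> v)"
    have nn: "0 \<le> x" if "x \<in> \<Lambda>" for x using psd_eigenvalue_nonneg[OF assms *(5)[OF that]] .
    let ?X = "\<Phi> inverse"
    have psd: "?X \<in> psd_mats" using nn by (intro *(4)) auto
    have c: "?X ** A = A ** ?X" by (simp add: *(1)[symmetric] *(2) mult.commute)
    have 1: "A ** (A ** ?X) = A" unfolding *(1)[symmetric] *(2) by (rule *(3)) (simp add: field_simps)
    have 2: "A ** (?X ** ?X) = ?X" unfolding *(1)[symmetric] *(2) by (rule *(3)) (simp add: field_simps)
    have h: "mat_adj (A ** ?X) = A ** ?X" using c psd assms by (simp add: mat_adj_mult psd_adj)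
    have "mat_pinv A = ?X"
      by (rule mat_pinv_eqI) (use 1 2 h c in \<open>simp_all add: matrix_mul_assoc[symmetric] mult_eq_assoc[OF c]\<close>)
    then show ?thesis using psd c 1 2 by simp
  qed
  then show "mat_pinv A \<in> psd_mats" "mat_pinv A ** A = A ** mat_pinv A"
    "A ** (A ** mat_pinv A) = A" "A ** (mat_pinv A ** mat_pinv A) = mat_pinv A" by auto
qed

text \<open>The smallest eigenvalue works; it is capped by 1 to have a minimum over a nonempty set. Together with the converse below, positive definiteness
  becomes a condition inside the closed cone of positive semi-definite matrices.\<close>
lemma pd_lower_bound:
  fixes A :: "complex^'n^'n"
  assumes "A \<in> pd_mats"
  obtains c where "c > 0" "A - c *\<^sub>R mat 1 \<in> psd_mats"
proof (rule functional_calculus[OF psd_adj[OF pd_imp_psd[OF assms]]])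
  fix \<Phi> :: "(real \<Rightarrow> real) \<Rightarrow> complex^'n^'n" and \<Lambda> :: "real set"
  assume *: "\<Phi> (\<lambda>x. x) = A" "\<Phi> (\<lambda>x. 1) = mat 1" "\<And>f g. \<Phi> f - \<Phi> g = \<Phi> (\<lambda>x. f x - g x)"
    "\<And>f c. c *\<^sub>R \<Phi> f = \<Phi> (\<lambda>x. c * f x)"
    "\<And>f. (\<And>x. x \<in> \<Lambda> \<Longrightarrow> 0 \<le> f x) \<Longrightarrow> \<Phi> f \<in> psd_mats"
    "\<And>x. x \<in> \<Lambda> \<Longrightarrow> \<exists>v. v \<noteq> 0 \<and> v \<bullet> (A *v v) = x * (v \<bullet> v)" and fin: "finite \<Lambda>"
  have pos: "0 < x" if "x \<in> \<Lambda>" for x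
  proof -
    from *(6)[OF that] obtain v where v: "v \<noteq> 0" "v \<bullet> (A *v v) = x * (v \<bullet> v)" by blast
    have "0 < v \<bullet> (A *v v)" "0 < v \<bullet> v" using assms v(1) by (simp_all add: pd_mats_iff)
    then show ?thesis by (simp add: v(2) zero_less_mult_iff)
  qed
  define c where "c = Min (insert 1 \<Lambda>)"
  have "A - c *\<^sub>R mat 1 = \<Phi> (\<lambda>x. x - c * 1)"
    by (simp only: *(1)[symmetric] *(2)[symmetric] *(3,4))
  also have "\<dots> \<in> psd_mats" by (rule *(5)) (use fin in \<open>simp add: c_def\<close>)
  finally have "A - c *\<^sub>R mat 1 \<in> psd_mats" .
  moreover have "c > 0" using fin pos by (simp add: c_def)
  ultimately show thesis using that by blast
qed

lemma quadratic_form_diff_one: "x \<bullet> ((A - c *\<^sub>R mat 1) *v x) = x \<bullet> (A *v x) - c * (x \<bullet> x)"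
  for A :: "complex^'n^'n"
  by (simp add: matrix_vector_mult_diff_rdistrib inner_diff_right flip: scaleR_matvec)

lemma pd_if_lower_bound:
  fixes A :: "complex^'n^'n"
  assumes "c > 0" "A - c *\<^sub>R mat 1 \<in> psd_mats"
  shows "A \<in> pd_mats"
proof -
  have "0 < x \<bullet> (A *v x)" if "x \<noteq> 0" for x
  proof -
    have "c * (x \<bullet> x) \<le> x \<bullet> (A *v x)"
      using assms(2) unfolding psd_mats_iff quadratic_form_diff_one by simp
    moreover have "0 < c * (x \<bullet> x)" using assms(1) that by simp
    ultimately show ?thesis by linarith
  qed
  moreover have "mat_adj A = A"
    using psd_adj[OF assms(2)] by (simp add: mat_adj_diff mat_adj_scaleR)
  ultimately show ?thesis by (simp add: pd_mats_iff)
qed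

lemma psd_inner_lower_bound:
  fixes A T :: "complex^'n^'n"
  assumes "A - c *\<^sub>R mat 1 \<in> psd_mats" "T \<in> psd_mats"
  shows "c * (mat 1 \<bullet> T) \<le> T \<bullet> A"
  using psd_inner_nonneg[OF assms(2,1)] by (simp add: inner_diff_right inner_commute)

lemma pd_mult_eq_0:
  fixes A B :: "complex^'n^'n"
  assumes "A \<in> pd_mats" "A ** B = 0"
  shows "B = 0"
proof -
  obtain c where c: "c > 0" "A - c *\<^sub>R mat 1 \<in> psd_mats" using pd_lower_bound[OF assms(1)] .
  from psd_inner_mult(1)[OF c(2), of B] have "c * (B \<bullet> B) \<le> 0"
    by (simp add: matrix_mult.diff_left matrix_mult.scaleR_left assms inner_diff_right)
  with c(1) have "B \<bullet> B \<le> 0" by (simp add: mult_le_0_iff)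
  then show ?thesis by (metis inner_ge_zero inner_eq_zero_iff order_antisym)
qed

lemma pd_pinv:
  assumes "A \<in> pd_mats" shows "A ** mat_pinv A = mat 1" "mat_pinv A ** A = mat 1"
proof -
  have "A ** (A ** mat_pinv A - mat 1) = 0"
    by (simp add: matrix_mult.diff_right mat_pinv_1 pd_imp_psd assms)
  from pd_mult_eq_0[OF assms this] show "A ** mat_pinv A = mat 1" by simp
  then show "mat_pinv A ** A = mat 1" by (simp add: mat_pinv_commute pd_imp_psd assms)
qed

section \<open>Polar decomposition and the transport map\<close>

text \<open>\<open>W\<close> is the partial isometry of the polar decomposition \<open>C = W R\<close>. The last identity computes
  \<open>\<surd>(C C\<^sup>*)\<close> from \<open>\<surd>(C\<^sup>* C)\<close> and holds for singular \<open>C\<close> too, since \<open>C\<close> vanishes on the kernel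
  of \<open>R\<close>: this is what links the two expressions for the transport map.\<close>
lemma polar:
  fixes C :: "complex^'n^'n"
  defines "R \<equiv> mat_sqrt (mat_adj C ** C)"
  defines "W \<equiv> C ** mat_pinv R"
  shows "mat_adj W ** C = R"
    and "(W ** mat_adj W) ** (W ** mat_adj W) = W ** mat_adj W"
    and "mat_sqrt (C ** mat_adj C) = C ** mat_pinv R ** mat_adj C"
proof -
  let ?X = "mat_pinv R"
  have R: "R \<in> psd_mats" "mat_adj C ** C = R ** R"
    unfolding R_def by (simp_all add: mat_sqrt psd_gram)
  note rX = mat_pinv[OF R(1)]
  have aX: "mat_adj ?X = ?X" and aR: "mat_adj R = R" using rX R by (simp_all add: psd_adj)
  note rules = matrix_mul_assoc[symmetric] R(2) mult_eq_assoc[OF R(2)] rX(2) mult_eq_assoc[OF rX(2)]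
    rX(3) rX(4) mult_eq_assoc[OF rX(3), unfolded matrix_mul_assoc[symmetric]]
    mult_eq_assoc[OF rX(4), unfolded matrix_mul_assoc[symmetric]]
  let ?D = "C - C ** (R ** ?X)"
  \<comment> \<open>\<open>R ** ?X\<close> is the projection onto the range of \<open>R\<close>; the following shows \<open>C = C R X\<close>.\<close>
  have "mat_adj ?D ** ?D = 0"
    by (simp add: mat_adj_diff mat_adj_mult aX aR matrix_mult.diff_left matrix_mult.diff_right rules)
  then have C: "C ** (R ** ?X) = C" using adj_mult_self_eq_0[of ?D] by simp
  show "mat_adj W ** C = R" by (simp add: W_def mat_adj_mult aX rules)
  show "(W ** mat_adj W) ** (W ** mat_adj W) = W ** mat_adj W"
    by (simp add: W_def mat_adj_mult aX rules)
  show "mat_sqrt (C ** mat_adj C) = C ** ?X ** mat_adj C"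
  proof (rule mat_sqrt_eqI)
    show "C ** ?X ** mat_adj C \<in> psd_mats" using psd_congruence[OF rX(1), of "mat_adj C"] by simp
    show "C ** ?X ** mat_adj C ** (C ** ?X ** mat_adj C) = C ** mat_adj C"
      using mult_eq_assoc[OF C, of "mat_adj C"] by (simp add: rules)
  qed
qed

definition fidelity :: "complex^'n^'n \<Rightarrow> complex^'n^'n \<Rightarrow> real" where
  "fidelity Q S = mat 1 \<bullet> mat_sqrt (mat_sqrt Q ** S ** mat_sqrt Q)"

text \<open>The polar identity for \<open>C = \<surd>Q \<surd>S\<close>.\<close>
lemma ot_map:
  fixes Q S :: "complex^'n^'n"
  assumes Q: "Q \<in> psd_mats" and S: "S \<in> psd_mats"
  shows ot_map_psd: "ot_map Q S \<in> psd_mats"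
    and mat_sqrt_congruence_ot_map:
      "mat_sqrt (mat_sqrt Q ** S ** mat_sqrt Q) = mat_sqrt Q ** ot_map Q S ** mat_sqrt Q"
    and fidelity_ot_map: "fidelity Q S = ot_map Q S \<bullet> Q"
proof -
  let ?q = "mat_sqrt Q" and ?s = "mat_sqrt S"
  let ?R = "mat_sqrt (?s ** Q ** ?s)"
  have a: "mat_adj ?q = ?q" "mat_adj ?s = ?s" and qq: "?q ** ?q = Q" and ss: "?s ** ?s = S"
    using assms by (auto simp: mat_sqrt_adj mat_sqrt_square)
  have "?R \<in> psd_mats" by (intro mat_sqrt_psd psd_congruence_hermitian a Q)
  then show "ot_map Q S \<in> psd_mats"
    unfolding ot_map_def by (intro psd_congruence_hermitian a mat_pinv_psd)
  have "mat_adj (?q ** ?s) ** (?q ** ?s) = ?s ** (?q ** ?q) ** ?s"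
      "(?q ** ?s) ** mat_adj (?q ** ?s) = ?q ** (?s ** ?s) ** ?q"
    unfolding mat_adj_mult a by (simp_all only: matrix_mul_assoc)
  then have e: "mat_adj (?q ** ?s) ** (?q ** ?s) = ?s ** Q ** ?s"
      "(?q ** ?s) ** mat_adj (?q ** ?s) = ?q ** S ** ?q" unfolding qq ss .
  show r: "mat_sqrt (?q ** S ** ?q) = ?q ** ot_map Q S ** ?q"
    using polar(3)[of "?q ** ?s"] unfolding e unfolding mat_adj_mult a ot_map_def by (simp add: matrix_mul_assoc)
  show "fidelity Q S = ot_map Q S \<bullet> Q"
    unfolding fidelity_def r
    using inner_matmul_right[of "?q ** ot_map Q S" ?q "mat 1"] inner_matmul_left[of ?q "ot_map Q S" ?q]
    by (simp add: a qq inner_commute)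
qed

text \<open>Identities about \<open>T\<close> are known only after conjugation with \<open>\<surd>Q\<close>; this removes it.\<close>
lemma pd_mat_sqrt_cancel:
  fixes X Y :: "complex^'n^'n"
  assumes Q: "Q \<in> pd_mats" and eq: "mat_sqrt Q ** X ** mat_sqrt Q = mat_sqrt Q ** Y ** mat_sqrt Q"
  shows "X = Y"
proof -
  let ?q = "mat_sqrt Q"
  have Qp: "Q \<in> psd_mats" using Q by (rule pd_imp_psd)
  have q: "mat_adj ?q = ?q" "?q ** ?q = Q" using Qp by (simp_all add: mat_sqrt_adj mat_sqrt_square)
  have canc: "B = 0" if "?q ** B = 0" for B :: "complex^'n^'n"
    using pd_mult_eq_0[OF Q, of B] that mult_eq_assoc[OF q(2), of B] by simp
  have "?q ** ((X - Y) ** ?q) = 0"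
    using eq by (simp add: matrix_mul_assoc matrix_mult.diff_left matrix_mult.diff_right)
  then have "(X - Y) ** ?q = 0" by (rule canc)
  then have "mat_adj ((X - Y) ** ?q) = 0" by (simp add: mat_adj_zero)
  then have "mat_adj (X - Y) = 0" unfolding mat_adj_mult q(1) by (rule canc)
  then have "mat_adj (mat_adj (X - Y)) = 0" by (simp add: mat_adj_zero)
  then show ?thesis by simp
qed

lemma ot_map_transport:
  assumes Q: "Q \<in> pd_mats" and S: "S \<in> psd_mats"
  shows "ot_map Q S ** Q ** ot_map Q S = S"
proof (rule pd_mat_sqrt_cancel[OF Q])
  let ?q = "mat_sqrt Q"
  have Qp: "Q \<in> psd_mats" using Q by (rule pd_imp_psd)
  have q: "mat_adj ?q = ?q" "?q ** ?q = Q" using Qp by (simp_all add: mat_sqrt_adj mat_sqrt_square)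
  have "(?q ** ot_map Q S ** ?q) ** (?q ** ot_map Q S ** ?q) = ?q ** S ** ?q"
    unfolding mat_sqrt_congruence_ot_map[OF Qp S, symmetric]
    by (intro mat_sqrt_square psd_congruence_hermitian S q)
  moreover have "(?q ** ot_map Q S ** ?q) ** (?q ** ot_map Q S ** ?q) =
      ?q ** (ot_map Q S ** (?q ** ?q) ** ot_map Q S) ** ?q" by (simp add: matrix_mul_assoc)
  ultimately show "?q ** (ot_map Q S ** Q ** ot_map Q S) ** ?q = ?q ** S ** ?q"
    by (simp add: q)
qed

lemma ot_map_unique:
  assumes Q: "Q \<in> pd_mats" and T: "T \<in> psd_mats" "T ** Q ** T = S"
  shows "T = ot_map Q S"
proof (rule pd_mat_sqrt_cancel[OF Q])
  let ?q = "mat_sqrt Q"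
  have Qp: "Q \<in> psd_mats" using Q by (rule pd_imp_psd)
  have q: "mat_adj ?q = ?q" "?q ** ?q = Q" using Qp by (simp_all add: mat_sqrt_adj mat_sqrt_square)
  have S: "S \<in> psd_mats" using T psd_congruence[OF Qp, of T] by (simp add: psd_adj)
  have "(?q ** T ** ?q) ** (?q ** T ** ?q) = ?q ** (T ** (?q ** ?q) ** T) ** ?q"
    by (simp add: matrix_mul_assoc)
  then have "mat_sqrt (?q ** S ** ?q) = ?q ** T ** ?q"
    by (intro mat_sqrt_eqI psd_congruence_hermitian T q) (simp add: q T)
  then show "?q ** T ** ?q = ?q ** ot_map Q S ** ?q"
    using mat_sqrt_congruence_ot_map[OF Qp S] by simp
qed

text \<open>Put \<open>E = \<surd>T \<surd>Q\<close> and \<open>F = \<surd>T \<surd>Q'\<close>, and let \<open>W\<close> be the partial isometry of the polar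
  decomposition of \<open>C = E\<^sup>* F\<close>. As \<open>S = T Q T\<close>, the fidelity of \<open>Q'\<close> and \<open>S\<close> is the trace norm of \<open>C\<close>,
  that is \<open>\<langle>E W, F\<rangle>\<close>, while \<open>\<parallel>E\<parallel>\<^sup>2 = \<langle>T,Q\<rangle>\<close> and \<open>\<parallel>F\<parallel>\<^sup>2 = \<langle>T,Q'\<rangle>\<close>. With the projection
  \<open>N = W W\<^sup>*\<close> this yields the exact identity
  \<open>\<langle>T,Q\<rangle> + \<langle>T,Q'\<rangle> - 2 F(Q',S) = \<parallel>E W - F\<parallel>\<^sup>2 + \<parallel>E - E N\<parallel>\<^sup>2\<close>.
  If the right-hand side vanishes, then \<open>F F\<^sup>* = E N E\<^sup>* = E E\<^sup>*\<close>, that is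
  \<open>\<surd>T Q' \<surd>T = \<surd>T Q \<surd>T\<close>, and \<open>T\<close> can be cancelled if \<open>S\<close>, hence \<open>T\<close>, is invertible.\<close>
theorem fidelity_subgradient:
  fixes Q Q' S :: "complex^'n^'n"
  assumes Q: "Q \<in> pd_mats" and Q': "Q' \<in> psd_mats" and S: "S \<in> psd_mats"
  shows "2 * fidelity Q' S \<le> ot_map Q S \<bullet> Q + ot_map Q S \<bullet> Q'"
    and "\<lbrakk>S \<in> pd_mats; 2 * fidelity Q' S = ot_map Q S \<bullet> Q + ot_map Q S \<bullet> Q'\<rbrakk> \<Longrightarrow> Q' = Q"
proof -
  define T where "T = ot_map Q S"
  let ?t = "mat_sqrt T" and ?q = "mat_sqrt Q" and ?p = "mat_sqrt Q'"
  have Qp: "Q \<in> psd_mats" using Q by (rule pd_imp_psd)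
  have T: "T \<in> psd_mats" "T ** Q ** T = S" unfolding T_def using Q S Qp by (auto simp: ot_map_psd ot_map_transport)
  note a = mat_sqrt_adj[OF T(1)] mat_sqrt_adj[OF Qp] mat_sqrt_adj[OF Q']
  note sq = mat_sqrt_square[OF T(1)] mat_sqrt_square[OF Qp] mat_sqrt_square[OF Q']
  define E where "E = ?t ** ?q"
  define F where "F = ?t ** ?p"
  define C where "C = mat_adj E ** F"
  define R where "R = mat_sqrt (mat_adj C ** C)"
  define W where "W = C ** mat_pinv R"
  define N where "N = W ** mat_adj W"
  have "C = ?q ** (?t ** ?t) ** ?p"
    unfolding C_def E_def F_def mat_adj_mult a by (simp only: matrix_mul_assoc)
  then have C: "C = ?q ** T ** ?p" unfolding sq .
  have "mat_adj C ** C = ?p ** (T ** (?q ** ?q) ** T) ** ?p"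
    unfolding C mat_adj_mult a psd_adj[OF T(1)] by (simp add: matrix_mul_assoc)
  then have CC: "mat_adj C ** C = ?p ** S ** ?p" by (simp add: sq T)
  have NN: "N ** N = N" and WC: "mat_adj W ** C = R" unfolding N_def W_def R_def by (rule polar)+
  have aN: "mat_adj N = N" by (simp add: N_def mat_adj_mult)
  have fid: "fidelity Q' S = (E ** W) \<bullet> F"
  proof -
    have "fidelity Q' S = mat 1 \<bullet> (mat_adj W ** (mat_adj E ** F))"
      unfolding fidelity_def CC[symmetric] using WC by (simp add: R_def C_def)
    also have "\<dots> = (E ** W) \<bullet> F"
      using inner_matmul_left[of "E ** W" "mat 1" F] by (simp add: mat_adj_mult matrix_mul_assoc)
    finally show ?thesis .
  qed
  have norm_sq: "(?t ** B) \<bullet> (?t ** B) = T \<bullet> (B ** B)" if "mat_adj B = B" for B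
  proof -
    have "(?t ** B) \<bullet> (?t ** B) = B \<bullet> (T ** B)"
      unfolding inner_matmul_left a by (simp only: matrix_mul_assoc sq)
    also have "\<dots> = T \<bullet> (B ** B)" unfolding inner_commute[of B] inner_matmul_right that ..
    finally show ?thesis .
  qed
  have EE: "E \<bullet> E = T \<bullet> Q" and FF: "F \<bullet> F = T \<bullet> Q'"
    unfolding E_def F_def by (simp_all only: norm_sq a sq)
  have EW: "(E ** W) \<bullet> (E ** W) = E \<bullet> (E ** N)"
    by (simp add: inner_matmul_right N_def matrix_mul_assoc)
  have EN: "(E ** N) \<bullet> (E ** N) = E \<bullet> (E ** N)"
    by (simp add: inner_matmul_right aN matrix_mul_assoc[symmetric] NN)
  have id: "T \<bullet> Q + T \<bullet> Q' - 2 * fidelity Q' S = (norm (E ** W - F))\<^sup>2 + (norm (E - E ** N))\<^sup>2"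
    unfolding power2_norm_eq_inner fid EE[symmetric] FF[symmetric]
    by (simp add: inner_diff_left inner_diff_right EW EN inner_commute[of F "E ** W"] inner_commute[of "E ** N" E])
  show "2 * fidelity Q' S \<le> ot_map Q S \<bullet> Q + ot_map Q S \<bullet> Q'"
    using id unfolding T_def[symmetric] by (smt (verit) zero_le_power2)
  assume Spd: "S \<in> pd_mats" and eq: "2 * fidelity Q' S = ot_map Q S \<bullet> Q + ot_map Q S \<bullet> Q'"
  from id eq have "(norm (E ** W - F))\<^sup>2 + (norm (E - E ** N))\<^sup>2 = 0" by (simp add: T_def)
  then have F: "F = E ** W" and E: "E ** N = E" by (simp_all add: sum_power2_eq_zero_iff)
  have "F ** mat_adj F = E ** N ** mat_adj E" by (simp add: F N_def mat_adj_mult matrix_mul_assoc)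
  also have "\<dots> = E ** mat_adj E" by (simp add: E)
  finally have "?t ** (?p ** ?p) ** ?t = ?t ** (?q ** ?q) ** ?t"
    by (simp add: E_def F_def mat_adj_mult a matrix_mul_assoc)
  then have eq': "?t ** Q' ** ?t = ?t ** Q ** ?t" by (simp add: sq)
  have canc: "B = 0" if "T ** B = 0" for B :: "complex^'n^'n"
    using pd_mult_eq_0[OF Spd, of B] that by (simp add: matrix_mul_assoc[symmetric] flip: T(2))
  have "(?t ** ?t) ** (Q' - Q) ** (?t ** ?t) = ?t ** (?t ** Q' ** ?t) ** ?t - ?t ** (?t ** Q ** ?t) ** ?t"
    by (simp only: matrix_mul_assoc matrix_mult.diff_left matrix_mult.diff_right)
  then have "T ** ((Q' - Q) ** T) = 0" by (simp add: eq' sq matrix_mul_assoc)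
  then have "(Q' - Q) ** T = 0" by (rule canc)
  then have "mat_adj ((Q' - Q) ** T) = 0" by (simp only: mat_adj_zero)
  then have "T ** (Q' - Q) = 0" using Q' Qp T by (simp add: mat_adj_mult mat_adj_diff psd_adj)
  then have "Q' - Q = 0" by (rule canc)
  then show "Q' = Q" by simp
qed

section \<open>Continuity and bounds\<close>

text \<open>On compact sets a continuous injection has a continuous inverse. This gives continuity of
  solutions of equations such as \<open>R\<^sup>2 = A\<close> and \<open>T Q T = S\<close> in their data from uniqueness and an a
  priori bound alone.\<close>
lemma tendsto_inverse_image:
  fixes h :: "'a::{heine_borel, real_normed_vector} \<Rightarrow> 'b::t2_space" and x :: "nat \<Rightarrow> 'a"
  assumes D: "closed D" and h: "continuous_on D h" "inj_on h D"
    and x: "\<And>k. x k \<in> D" "\<And>k. norm (x k) \<le> b" and a: "a \<in> D" "(\<lambda>k. h (x k)) \<longlonglongrightarrow> h a"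
  shows "x \<longlonglongrightarrow> a"
proof -
  define K where "K = D \<inter> cball 0 (max b (norm a))"
  have K: "compact K" using D by (simp add: K_def closed_Int_compact)
  have inj: "inj_on h K" using h(2) by (rule inj_on_subset) (auto simp: K_def)
  let ?g = "the_inv_into K h"
  have g: "?g (h y) = y" if "y \<in> K" for y using the_inv_into_f_f[OF inj that] .
  have "continuous_on K h" using h(1) by (rule continuous_on_subset) (auto simp: K_def)
  then have "continuous_on (h ` K) ?g" using K g by (intro continuous_on_inv) auto
  moreover have xK: "x k \<in> K" for k using x by (auto simp: K_def le_max_iff_disj)
  moreover have aK: "a \<in> K" using a by (auto simp: K_def)
  ultimately have "(\<lambda>k. ?g (h (x k))) \<longlonglongrightarrow> ?g (h a)"
    by (intro continuous_on_tendsto_compose[OF _ a(2)]) auto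
  then show ?thesis by (simp add: g xK aK)
qed

lemma norm_mat_sqrt: "A \<in> psd_mats \<Longrightarrow> (norm (mat_sqrt A))\<^sup>2 = mat 1 \<bullet> A"
  using inner_matmul_left[of "mat_sqrt A" "mat 1" "mat_sqrt A"]
  by (simp add: power2_norm_eq_inner mat_sqrt_adj mat_sqrt_square)

lemma trace_le_norm: "mat 1 \<bullet> A \<le> norm (mat 1 :: complex^'n^'n) * norm A" for A :: "complex^'n^'n"
  by (rule norm_cauchy_schwarz)

lemma continuous_on_mat_sqrt: "continuous_on psd_mats (mat_sqrt :: complex^'n^'n \<Rightarrow> _)"
  unfolding continuous_on_sequentially o_def
proof safe
  fix x :: "nat \<Rightarrow> complex^'n^'n" and a
  assume a: "a \<in> psd_mats" and x: "\<forall>n. x n \<in> psd_mats" and lim: "x \<longlonglongrightarrow> a"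
  obtain B where B: "norm (x k) \<le> B" for k
    using lim convergent_imp_Bseq[of x] by (auto simp: convergent_def Bseq_def)
  show "(\<lambda>n. mat_sqrt (x n)) \<longlonglongrightarrow> mat_sqrt a"
  proof (rule tendsto_inverse_image[OF closed_psd])
    show "continuous_on psd_mats (\<lambda>R::complex^'n^'n. R ** R)"
      by (intro matrix_mult.continuous_on continuous_on_id)
    show "inj_on (\<lambda>R::complex^'n^'n. R ** R) psd_mats"
      by (auto intro!: inj_onI psd_sqrt_unique)
    show "mat_sqrt (x k) \<in> psd_mats" for k using x by (simp add: mat_sqrt_psd)
    show "norm (mat_sqrt (x k)) \<le> sqrt (norm (mat 1 :: complex^'n^'n) * B)" for k
    proof (rule real_le_rsqrt)
      have "(norm (mat_sqrt (x k)))\<^sup>2 \<le> norm (mat 1 :: complex^'n^'n) * norm (x k)"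
        using x trace_le_norm[of "x k"] by (simp add: norm_mat_sqrt)
      also have "\<dots> \<le> norm (mat 1 :: complex^'n^'n) * B" by (intro mult_left_mono B) simp
      finally show "(norm (mat_sqrt (x k)))\<^sup>2 \<le> norm (mat 1 :: complex^'n^'n) * B" .
    qed
    show "mat_sqrt a \<in> psd_mats" using a by (rule mat_sqrt_psd)
    show "(\<lambda>k. mat_sqrt (x k) ** mat_sqrt (x k)) \<longlonglongrightarrow> mat_sqrt a ** mat_sqrt a"
      using a x lim by (simp add: mat_sqrt_square)
  qed
qed

lemma continuous_on_sqrt_congruence:
  fixes f g :: "'a::topological_space \<Rightarrow> complex^'n^'n"
  assumes "continuous_on X f" "continuous_on X g" "f ` X \<subseteq> psd_mats" "g ` X \<subseteq> psd_mats"
  shows "continuous_on X (\<lambda>x. mat_sqrt (mat_sqrt (f x) ** g x ** mat_sqrt (f x)))"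
proof (rule continuous_on_compose2[OF continuous_on_mat_sqrt])
  have "continuous_on X (\<lambda>x. mat_sqrt (f x))"
    by (rule continuous_on_compose2[OF continuous_on_mat_sqrt]) (use assms in auto)
  then show "continuous_on X (\<lambda>x. mat_sqrt (f x) ** g x ** mat_sqrt (f x))"
    by (intro matrix_mult.continuous_on assms)
  show "(\<lambda>x. mat_sqrt (f x) ** g x ** mat_sqrt (f x)) ` X \<subseteq> psd_mats"
    using assms(3,4) by (auto intro!: psd_congruence_hermitian mat_sqrt_adj)
qed

lemma continuous_on_fidelity:
  fixes f g :: "'a::topological_space \<Rightarrow> complex^'n^'n"
  assumes "continuous_on X f" "continuous_on X g" "f ` X \<subseteq> psd_mats" "g ` X \<subseteq> psd_mats"
  shows "continuous_on X (\<lambda>x. fidelity (f x) (g x))"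
  unfolding fidelity_def
  by (intro continuous_on_inner continuous_on_const continuous_on_sqrt_congruence assms)

lemma fidelity_nonneg: "\<lbrakk>Q \<in> psd_mats; S \<in> psd_mats\<rbrakk> \<Longrightarrow> 0 \<le> fidelity Q S"
  unfolding fidelity_def
  by (intro psd_inner_nonneg psd_one mat_sqrt_psd psd_congruence_hermitian mat_sqrt_adj)

lemma trace_psd_nonneg: "Q \<in> psd_mats \<Longrightarrow> 0 \<le> mat 1 \<bullet> Q"
  by (intro psd_inner_nonneg psd_one)

text \<open>From \<open>tr R \<le> \<parallel>I\<parallel> \<parallel>R\<parallel>\<close> and \<open>\<parallel>R\<parallel>\<^sup>2 = \<langle>Q,S\<rangle> \<le> tr Q tr S\<close> by the arithmetic-geometric mean inequality,
  weighted so that the coefficient of \<open>tr Q\<close> stays below 1: this makes the cost coercive.\<close>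
lemma fidelity_le:
  fixes Q S :: "complex^'n^'n"
  assumes Q: "Q \<in> psd_mats" and S: "S \<in> psd_mats"
  shows "2 * fidelity Q S \<le> (mat 1 \<bullet> Q) / 2 + 2 * (norm (mat 1 :: complex^'n^'n))\<^sup>2 * (mat 1 \<bullet> S)"
proof -
  let ?q = "mat_sqrt Q" and ?n = "norm (mat 1 :: complex^'n^'n)"
  let ?R = "mat_sqrt (?q ** S ** ?q)"
  let ?a = "mat 1 \<bullet> Q" and ?b = "mat 1 \<bullet> S"
  have a: "mat_adj ?q = ?q" "?q ** ?q = Q" using Q by (simp_all add: mat_sqrt_adj mat_sqrt_square)
  have nn: "0 \<le> ?a" "0 \<le> ?b" using Q S by (simp_all add: trace_psd_nonneg)
  have "(norm ?R)\<^sup>2 = mat 1 \<bullet> (?q ** S ** ?q)"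
    by (intro norm_mat_sqrt psd_congruence_hermitian S a)
  also have "\<dots> = Q \<bullet> S"
    using inner_matmul_right[of "?q ** S" ?q "mat 1"] inner_matmul_left[of ?q S ?q]
    by (simp add: a inner_commute)
  also have "\<dots> \<le> norm Q * norm S" by (rule norm_cauchy_schwarz)
  also have "\<dots> \<le> ?a * ?b" using nn Q S by (intro mult_mono psd_norm_le_trace) auto
  finally have R: "(norm ?R)\<^sup>2 \<le> ?a * ?b" .
  have "(2 * ?n * norm ?R)\<^sup>2 = 4 * ?n\<^sup>2 * (norm ?R)\<^sup>2" by (simp add: power_mult_distrib)
  also have "\<dots> \<le> 4 * ?n\<^sup>2 * (?a * ?b)" by (intro mult_left_mono R) simp
  also have "\<dots> \<le> (?a / 2 + 2 * ?n\<^sup>2 * ?b)\<^sup>2"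
    using zero_le_power2[of "?a / 2 - 2 * ?n\<^sup>2 * ?b"] by (simp add: power2_sum power2_diff mult_ac)
  finally have "2 * ?n * norm ?R \<le> ?a / 2 + 2 * ?n\<^sup>2 * ?b"
    by (rule power2_le_imp_le) (use nn in auto)
  then show ?thesis using trace_le_norm[of ?R] by (simp add: fidelity_def)
qed

lemma bw_dist_sq_eq: "bw_dist_sq Q S = mat 1 \<bullet> Q + mat 1 \<bullet> S - 2 * fidelity Q S"
  by (simp add: bw_dist_sq_def fidelity_def Re_trace_eq_inner)

text \<open>\<open>Q \<ge> c I\<close> implies \<open>c tr T \<le> \<langle>T,Q\<rangle> = F(Q,S)\<close>, and the trace dominates the norm.\<close>
lemma norm_ot_map_le:
  fixes Q S :: "complex^'n^'n"
  assumes c: "c > 0" "Q - c *\<^sub>R mat 1 \<in> psd_mats" and S: "S \<in> psd_mats"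
  shows "norm (ot_map Q S) \<le> fidelity Q S / c"
proof -
  have Q: "Q \<in> psd_mats" using c pd_if_lower_bound pd_imp_psd by blast
  have T: "ot_map Q S \<in> psd_mats" using Q S by (rule ot_map_psd)
  have "c * norm (ot_map Q S) \<le> c * (mat 1 \<bullet> ot_map Q S)"
    using c psd_norm_le_trace[OF T] by simp
  also have "\<dots> \<le> fidelity Q S"
    using psd_inner_lower_bound[OF c(2) T] by (simp add: fidelity_ot_map Q S)
  finally show ?thesis using c by (simp add: field_simps)
qed

text \<open>Along the sequence \<open>T\<^sub>k Q\<^sub>0 T\<^sub>k = S + T\<^sub>k (Q\<^sub>0 - Q\<^sub>k) T\<^sub>k\<close>, and the error term vanishes in the limit since
  the \<open>T\<^sub>k\<close> are bounded, by the common lower bound \<open>c\<close>. So \<open>T\<^sub>k\<close> solves the limit equation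
  asymptotically.\<close>
lemma tendsto_ot_map:
  fixes Q :: "nat \<Rightarrow> complex^'n^'n"
  assumes c: "c > 0" "\<And>k. Q k - c *\<^sub>R mat 1 \<in> psd_mats" and lim: "Q \<longlonglongrightarrow> Q0"
    and Q0: "Q0 \<in> pd_mats" and S: "S \<in> psd_mats"
  shows "(\<lambda>k. ot_map (Q k) S) \<longlonglongrightarrow> ot_map Q0 S"
proof -
  let ?n = "norm (mat 1 :: complex^'n^'n)" and ?T = "\<lambda>k. ot_map (Q k) S"
  have Q: "Q k \<in> pd_mats" "Q k \<in> psd_mats" for k
    using c pd_if_lower_bound pd_imp_psd by blast+
  obtain B where B: "norm (Q k) \<le> B" for k
    using lim convergent_imp_Bseq[of Q] by (auto simp: convergent_def Bseq_def)
  define b where "b = (?n * B / 4 + ?n\<^sup>2 * (mat 1 \<bullet> S)) / c"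
  have b: "norm (?T k) \<le> b" for k
  proof -
    have "mat 1 \<bullet> Q k \<le> ?n * B"
      using trace_le_norm[of "Q k"] mult_left_mono[OF B, of ?n k] by simp
    then have "fidelity (Q k) S \<le> ?n * B / 4 + ?n\<^sup>2 * (mat 1 \<bullet> S)"
      using fidelity_le[OF Q(2)[of k] S] by simp
    then have "fidelity (Q k) S / c \<le> b" unfolding b_def using c by (intro divide_right_mono) auto
    then show ?thesis using norm_ot_map_le[OF c(1) c(2) S, of k] by simp
  qed
  have psd: "?T k \<in> psd_mats" for k using Q S by (simp add: ot_map_psd)
  have inj: "inj_on (\<lambda>T. T ** Q0 ** T) psd_mats"
    using ot_map_unique[OF Q0] by (auto intro!: inj_onI) metis
  have lim': "(\<lambda>k. ?T k ** Q0 ** ?T k) \<longlonglongrightarrow> ot_map Q0 S ** Q0 ** ot_map Q0 S"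
  proof -
    have e: "?T k ** Q0 ** ?T k - S = ?T k ** (Q0 - Q k) ** ?T k" for k
      using ot_map_transport[OF Q(1) S, of k] by (simp add: matrix_mult.diff_left matrix_mult.diff_right)
    have "Zfun (\<lambda>k. Q0 - Q k) sequentially"
      using tendsto_diff[OF tendsto_const[of Q0] lim] by (simp add: tendsto_Zfun_iff)
    moreover have "Bfun ?T sequentially" using b by (intro BfunI[of _ b]) auto
    ultimately have "Zfun (\<lambda>k. ?T k ** (Q0 - Q k) ** ?T k) sequentially"
      by (intro matrix_mult.Zfun_prod_Bfun matrix_mult.Bfun_prod_Zfun)
    then have "(\<lambda>k. ?T k ** Q0 ** ?T k) \<longlonglongrightarrow> S" by (simp add: tendsto_Zfun_iff e)
    then show ?thesis by (simp add: ot_map_transport Q0 S)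
  qed
  show ?thesis
    by (rule tendsto_inverse_image[OF closed_psd _ inj psd b _ lim'])
      (intro matrix_mult.continuous_on continuous_on_id continuous_on_const ot_map_psd pd_imp_psd Q0 S)+
qed

text \<open>Continuity in the second argument, from \<open>T = Q\<^sup>-\<^sup>1 \<surd>Q \<surd>(\<surd>Q S \<surd>Q) \<surd>Q Q\<^sup>-\<^sup>1\<close>; it provides
  measurability.\<close>
lemma continuous_on_ot_map:
  fixes Q :: "complex^'n^'n"
  assumes Q: "Q \<in> pd_mats"
  shows "continuous_on psd_mats (\<lambda>S. ot_map Q S)"
proof -
  let ?q = "mat_sqrt Q" and ?X = "mat_pinv Q"
  let ?R = "\<lambda>S. mat_sqrt (?q ** S ** ?q)"
  have Qp: "Q \<in> psd_mats" using Q by (rule pd_imp_psd)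
  have "?X ** ?q ** ?R S ** ?q ** ?X = ot_map Q S" if "S \<in> psd_mats" for S
  proof -
    have "?X ** ?q ** ?R S ** ?q ** ?X = (?X ** (?q ** ?q)) ** ot_map Q S ** ((?q ** ?q) ** ?X)"
      unfolding mat_sqrt_congruence_ot_map[OF Qp that] by (simp only: matrix_mul_assoc)
    then show ?thesis by (simp add: mat_sqrt_square Qp pd_pinv Q)
  qed
  moreover have "continuous_on psd_mats (\<lambda>S. ?X ** ?q ** ?R S ** ?q ** ?X)"
    by (intro matrix_mult.continuous_on continuous_on_const continuous_on_sqrt_congruence continuous_on_id)
      (use Qp in auto)
  ultimately show ?thesis by (simp cong: continuous_on_cong)
qed

section \<open>Perturbations inside the cone\<close>

lemma hermitian_add_multiple_one:
  fixes X :: "complex^'n^'n"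
  assumes "mat_adj X = X"
  obtains L where "L \<ge> 0" "X + L *\<^sub>R mat 1 \<in> psd_mats"
proof (rule functional_calculus[OF assms])
  fix \<Phi> :: "(real \<Rightarrow> real) \<Rightarrow> complex^'n^'n" and \<Lambda> :: "real set"
  assume *: "\<Phi> (\<lambda>x. x) = X" "\<Phi> (\<lambda>x. 1) = mat 1" "\<And>f g. \<Phi> f - \<Phi> g = \<Phi> (\<lambda>x. f x - g x)"
    "\<And>f c. c *\<^sub>R \<Phi> f = \<Phi> (\<lambda>x. c * f x)"
    "\<And>f. (\<And>x. x \<in> \<Lambda> \<Longrightarrow> 0 \<le> f x) \<Longrightarrow> \<Phi> f \<in> psd_mats" and fin: "finite \<Lambda>"
  define L where "L = Max (insert 0 (uminus ` \<Lambda>))"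
  have "X + L *\<^sub>R mat 1 = X - (- L) *\<^sub>R mat 1" by simp
  also have "\<dots> = \<Phi> (\<lambda>x. x - (- L) * 1)" by (simp only: *(1)[symmetric] *(2)[symmetric] *(3,4))
  also have "\<dots> \<in> psd_mats"
  proof (rule *(5))
    fix x assume "x \<in> \<Lambda>"
    then have "- x \<le> L" unfolding L_def by (intro Max_ge) (use fin in auto)
    then show "0 \<le> x - (- L) * 1" by simp
  qed
  finally have "X + L *\<^sub>R mat 1 \<in> psd_mats" .
  moreover have "L \<ge> 0" unfolding L_def by (intro Max_ge) (use fin in auto)
  ultimately show thesis using that by blast
qed

text \<open>Choose \<open>L\<close> with \<open>X + L I \<ge> 0\<close> and spend half of the lower bound of \<open>Q\<close> on the loss \<open>t L\<close>.\<close>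
lemma psd_lower_bound_on_direction:
  fixes Q X :: "complex^'n^'n"
  assumes Q: "Q \<in> pd_mats" and X: "mat_adj X = X"
  obtains c \<delta> where "c > 0" "\<delta> > 0" "\<And>t. \<lbrakk>0 \<le> t; t \<le> \<delta>\<rbrakk> \<Longrightarrow> Q + t *\<^sub>R X - c *\<^sub>R mat 1 \<in> psd_mats"
proof -
  obtain c where c: "c > 0" "Q - c *\<^sub>R mat 1 \<in> psd_mats" using pd_lower_bound[OF Q] .
  obtain L where L: "L \<ge> 0" "X + L *\<^sub>R mat 1 \<in> psd_mats" using hermitian_add_multiple_one[OF X] .
  define \<delta> where "\<delta> = c / (2 * (L + 1))"
  have "\<delta> > 0" using c L by (simp add: \<delta>_def)
  have "Q + t *\<^sub>R X - (c / 2) *\<^sub>R mat 1 \<in> psd_mats" if t: "0 \<le> t" "t \<le> \<delta>" for t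
  proof -
    have "t * L \<le> \<delta> * (L + 1)" using t L by (intro mult_mono) auto
    also have "\<dots> = c / 2" using L by (simp add: \<delta>_def field_simps)
    finally have "0 \<le> c / 2 - t * L" by simp
    then have "(Q - c *\<^sub>R mat 1) + t *\<^sub>R (X + L *\<^sub>R mat 1) + (c / 2 - t * L) *\<^sub>R mat 1 \<in> psd_mats"
      by (intro psd_add[OF psd_add[OF c(2) psd_scaleR[OF t(1) L(2)]] psd_scaleR[OF _ psd_one]])
    moreover have "(Q - c *\<^sub>R mat 1) + t *\<^sub>R (X + L *\<^sub>R mat 1) + (c / 2 - t * L) *\<^sub>R mat 1
        = Q + t *\<^sub>R X - (c / 2) *\<^sub>R mat 1"
    proof -
      have "c *\<^sub>R (mat 1 :: complex^'n^'n) = (c / 2) *\<^sub>R mat 1 + (c / 2) *\<^sub>R mat 1"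
        by (simp flip: scaleR_left_distrib)
      then show ?thesis by (simp add: scaleR_add_right scaleR_diff_left)
    qed
    ultimately show ?thesis by simp
  qed
  then show thesis using that[of "c / 2" \<delta>] c \<open>\<delta> > 0\<close> by simp
qed

lemma pd_segment:
  fixes Q Q1 :: "complex^'n^'n"
  assumes "Q \<in> psd_mats" "Q1 \<in> pd_mats" "0 < t" "t \<le> 1"
  shows "Q + t *\<^sub>R (Q1 - Q) \<in> pd_mats"
proof -
  obtain c where c: "c > 0" "Q1 - c *\<^sub>R mat 1 \<in> psd_mats" using pd_lower_bound[OF assms(2)] .
  have "(1 - t) *\<^sub>R Q + t *\<^sub>R (Q1 - c *\<^sub>R mat 1) \<in> psd_mats"
    using assms c by (intro psd_add psd_scaleR) auto
  moreover have "(1 - t) *\<^sub>R Q + t *\<^sub>R (Q1 - c *\<^sub>R mat 1) = Q + t *\<^sub>R (Q1 - Q) - (t * c) *\<^sub>R mat 1"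
    by (simp add: algebra_simps)
  ultimately show ?thesis using pd_if_lower_bound[of "t * c" "Q + t *\<^sub>R (Q1 - Q)"] assms c by simp
qed

text \<open>The projection onto the kernel of \<open>Q\<close> is such a \<open>V\<close>.\<close>
lemma psd_kernel:
  fixes Q :: "complex^'n^'n"
  assumes Q: "Q \<in> psd_mats" "Q \<notin> pd_mats"
  obtains V :: "complex^'n^'n" where "V \<noteq> 0" "Q ** V = 0"
proof -
  let ?V = "mat 1 - Q ** mat_pinv Q"
  have "Q ** ?V = 0" using mat_pinv_1[OF Q(1)] by (simp add: matrix_mult.diff_right)
  moreover have "?V \<noteq> 0"
  proof
    assume "?V = 0"
    then have inv: "mat_pinv Q ** Q = mat 1" using mat_pinv_commute[OF Q(1)] by simp
    have "0 < x \<bullet> (Q *v x)" if "x \<noteq> 0" for x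
    proof (rule ccontr)
      let ?q = "mat_sqrt Q"
      have q: "mat_adj ?q = ?q" "?q ** ?q = Q" using Q by (simp_all add: mat_sqrt_adj mat_sqrt_square)
      have qq: "?q *v (?q *v y) = Q *v y" for y by (simp add: matrix_vector_mul_assoc q)
      have e: "x \<bullet> (Q *v x) = (?q *v x) \<bullet> (?q *v x)"
        using inner_matrix_vector[of x ?q "?q *v x"] by (simp add: q qq)
      assume "\<not> 0 < x \<bullet> (Q *v x)"
      then have "?q *v x = 0" unfolding e by simp
      then have "Q *v x = 0" using qq[of x] by simp
      then have "mat 1 *v x = 0" unfolding inv[symmetric] by (simp add: matrix_vector_mul_assoc[symmetric])
      with that show False by simp
    qed
    then show False using Q psd_adj[OF Q(1)] by (simp add: pd_mats_iff)
  qed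
  ultimately show thesis using that by blast
qed

text \<open>Let \<open>V\<close> be a nonzero matrix with \<open>Q V = 0\<close>, and write \<open>V = T Y\<close>, which is possible because
  \<open>S = T Q\<^sub>t T\<close> is invertible. Then \<open>s \<parallel>Y\<parallel>\<^sup>2 \<le> \<langle>Y, S Y\<rangle> = \<langle>V, Q\<^sub>t V\<rangle> = t \<langle>V, D V\<rangle>\<close> is of order \<open>t\<close>, so \<open>Y\<close>
  is small and \<open>T\<close> must be large.\<close>
lemma ot_map_blows_up:
  fixes Q D :: "complex^'n^'n"
  assumes Q: "Q \<in> psd_mats" "Q \<notin> pd_mats" and s: "s > 0"
  obtains b where "b > 0"
    "\<And>t S. \<lbrakk>t > 0; Q + t *\<^sub>R D \<in> pd_mats; S - s *\<^sub>R mat 1 \<in> psd_mats\<rbrakk>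
      \<Longrightarrow> b \<le> t * (mat 1 \<bullet> ot_map (Q + t *\<^sub>R D) S)\<^sup>2"
proof -
  obtain V :: "complex^'n^'n" where V: "V \<noteq> 0" "Q ** V = 0" using psd_kernel[OF Q] .
  obtain K where K: "K > 0" "\<And>(A :: complex^'n^'n) (B :: complex^'n^'n). norm (A ** B) \<le> norm A * norm B * K"
    using matrix_mult.pos_bounded by blast
  \<comment> \<open>The summand 1 makes \<open>a\<close> positive, so that it can be divided by.\<close>
  define a where "a = \<bar>V \<bullet> (D ** V)\<bar> + 1"
  have a: "a > 0" by (simp add: a_def)
  show thesis
  proof (rule that[of "s * (norm V)\<^sup>2 / (a * K\<^sup>2)"])
    show "0 < s * (norm V)\<^sup>2 / (a * K\<^sup>2)" using s a K V by simp
    fix t :: real and S :: "complex^'n^'n"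
    assume t: "t > 0" and pd: "Q + t *\<^sub>R D \<in> pd_mats" and S: "S - s *\<^sub>R mat 1 \<in> psd_mats"
    let ?Q = "Q + t *\<^sub>R D"
    let ?T = "ot_map ?Q S"
    have Spd: "S \<in> pd_mats" using pd_if_lower_bound[OF s S] .
    have T: "?T \<in> psd_mats" "?T ** ?Q ** ?T = S"
      using pd Spd by (auto intro: ot_map_psd ot_map_transport pd_imp_psd)
    define Y where "Y = ?Q ** ?T ** mat_pinv S ** V"
    have TY: "?T ** Y = V"
    proof -
      have "?T ** Y = (?T ** ?Q ** ?T) ** mat_pinv S ** V" by (simp only: Y_def matrix_mul_assoc)
      then show ?thesis using pd_pinv[OF Spd] T by simp
    qed
    have "s * (norm Y)\<^sup>2 \<le> Y \<bullet> (S ** Y)"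
      using psd_inner_mult(1)[OF S, of Y]
      by (simp add: matrix_mult.diff_left matrix_mult.scaleR_left inner_diff_right power2_norm_eq_inner)
    also have "\<dots> = (?T ** Y) \<bullet> (?Q ** (?T ** Y))"
      by (subst T(2)[symmetric]) (simp only: inner_matmul_left psd_adj[OF T(1)] matrix_mul_assoc)
    also have "\<dots> = t * (V \<bullet> (D ** V))"
      by (simp add: TY matrix_mult.add_left V matrix_mult.scaleR_left)
    also have "\<dots> \<le> t * a" using t by (intro mult_left_mono) (auto simp: a_def)
    finally have Y: "s * (norm Y)\<^sup>2 \<le> t * a" .
    have "norm V \<le> norm ?T * norm Y * K" using K(2)[of ?T Y] by (simp add: TY)
    also have "\<dots> \<le> (mat 1 \<bullet> ?T) * norm Y * K"
      using K psd_norm_le_trace[OF T(1)] by (intro mult_right_mono) auto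
    finally have "(norm V)\<^sup>2 \<le> ((mat 1 \<bullet> ?T) * norm Y * K)\<^sup>2" by (intro power_mono) auto
    then have "s * (norm V)\<^sup>2 \<le> s * ((mat 1 \<bullet> ?T) * norm Y * K)\<^sup>2" using s by simp
    also have "\<dots> = (mat 1 \<bullet> ?T)\<^sup>2 * K\<^sup>2 * (s * (norm Y)\<^sup>2)" by (simp add: power_mult_distrib)
    also have "\<dots> \<le> (mat 1 \<bullet> ?T)\<^sup>2 * K\<^sup>2 * (t * a)" by (intro mult_left_mono Y) simp
    finally show "s * (norm V)\<^sup>2 / (a * K\<^sup>2) \<le> t * (mat 1 \<bullet> ?T)\<^sup>2"
      using a K by (simp add: field_simps)
  qed
qed

section \<open>The barycenter functional\<close>

locale psd_law = prob_space P for P :: "(complex^'n^'n) measure" +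
  assumes sets_P: "sets P = sets (restrict_space borel psd_mats)"
    and integrable_trace: "integrable P (\<lambda>S. mat 1 \<bullet> S)"
    and prob_pd: "prob pd_mats > 0"
begin

lemma space_P: "space P = psd_mats"
  using sets_eq_imp_space_eq[OF sets_P] by (simp add: space_restrict_space)

lemma borel_measurable_continuous:
  fixes f :: "complex^'n^'n \<Rightarrow> 'b::{second_countable_topology, banach}"
  assumes "continuous_on psd_mats f"
  shows "f \<in> borel_measurable P"
  using borel_measurable_continuous_on_restrict[OF assms] measurable_cong_sets[OF sets_P refl] by blast

definition mean_trace :: real where
  "mean_trace = (\<integral>S. mat 1 \<bullet> S \<partial>P)"

definition mean_fidelity :: "complex^'n^'n \<Rightarrow> real" where
  "mean_fidelity Q = (\<integral>S. fidelity Q S \<partial>P)"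

definition mean_ot :: "complex^'n^'n \<Rightarrow> complex^'n^'n" where
  "mean_ot Q = (\<integral>S. ot_map Q S \<partial>P)"

definition cost :: "complex^'n^'n \<Rightarrow> real" where
  "cost Q = (\<integral>S. bw_dist_sq Q S \<partial>P)"

text \<open>The integrable function that dominates the fidelity with every \<open>Q\<close> of trace at most \<open>r\<close>.\<close>
definition fidelity_majorant :: "real \<Rightarrow> complex^'n^'n \<Rightarrow> real" where
  "fidelity_majorant r S = r / 4 + (norm (mat 1 :: complex^'n^'n))\<^sup>2 * (mat 1 \<bullet> S)"

lemma integrable_fidelity_majorant: "integrable P (fidelity_majorant r)"
  unfolding fidelity_majorant_def
  by (intro Bochner_Integration.integrable_add integrable_const integrable_mult_right integrable_trace)

lemma fidelity_le_majorant:
  assumes "Q \<in> psd_mats" "S \<in> psd_mats" "mat 1 \<bullet> Q \<le> r"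
  shows "fidelity Q S \<le> fidelity_majorant r S"
  using fidelity_le[OF assms(1,2)] assms(3) by (simp add: fidelity_majorant_def)

lemma measurable_fidelity: "Q \<in> psd_mats \<Longrightarrow> fidelity Q \<in> borel_measurable P"
  by (intro borel_measurable_continuous continuous_on_fidelity[of psd_mats "\<lambda>_. Q" "\<lambda>S. S", simplified]) auto

lemma norm_fidelity_le:
  assumes "Q \<in> psd_mats" "mat 1 \<bullet> Q \<le> r"
  shows "AE S in P. norm (fidelity Q S) \<le> fidelity_majorant r S"
  using assms by (intro AE_I2) (simp add: space_P fidelity_nonneg fidelity_le_majorant)

lemma integrable_fidelity:
  assumes Q: "Q \<in> psd_mats" shows "integrable P (fidelity Q)"
proof -
  have "AE S in P. norm (fidelity Q S) \<le> norm (fidelity_majorant (mat 1 \<bullet> Q) S)"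
    using norm_fidelity_le[OF Q order_refl] by eventually_elim auto
  then show ?thesis
    by (rule Bochner_Integration.integrable_bound[OF integrable_fidelity_majorant measurable_fidelity[OF Q]])
qed

lemma cost_eq: "Q \<in> psd_mats \<Longrightarrow> cost Q = mat 1 \<bullet> Q + mean_trace - 2 * mean_fidelity Q"
  unfolding cost_def bw_dist_sq_eq mean_trace_def mean_fidelity_def
  by (simp add: integrable_fidelity integrable_trace prob_space)

lemma measurable_ot_map: "Q \<in> pd_mats \<Longrightarrow> ot_map Q \<in> borel_measurable P"
  by (intro borel_measurable_continuous continuous_on_ot_map)

lemma norm_ot_map_le_majorant:
  assumes "c > 0" "Q - c *\<^sub>R mat 1 \<in> psd_mats" "mat 1 \<bullet> Q \<le> r"
  shows "AE S in P. norm (ot_map Q S) \<le> fidelity_majorant r S / c"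
proof (rule AE_I2)
  fix S assume "S \<in> space P"
  then have S: "S \<in> psd_mats" by (simp add: space_P)
  have Q: "Q \<in> psd_mats" using assms pd_if_lower_bound pd_imp_psd by blast
  have "fidelity Q S / c \<le> fidelity_majorant r S / c"
    using assms fidelity_le_majorant[OF Q S] by (intro divide_right_mono) auto
  then show "norm (ot_map Q S) \<le> fidelity_majorant r S / c"
    using norm_ot_map_le[OF assms(1,2) S] by simp
qed

lemma integrable_ot_map:
  assumes Q: "Q \<in> pd_mats" shows "integrable P (ot_map Q)"
proof -
  obtain c where c: "c > 0" "Q - c *\<^sub>R mat 1 \<in> psd_mats" using pd_lower_bound[OF Q] .
  have i: "integrable P (\<lambda>S. fidelity_majorant (mat 1 \<bullet> Q) S / c)"
    by (intro integrable_divide integrable_fidelity_majorant)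
  have "AE S in P. norm (ot_map Q S) \<le> norm (fidelity_majorant (mat 1 \<bullet> Q) S / c)"
    using norm_ot_map_le_majorant[OF c order_refl]
    by eventually_elim (simp only: real_norm_def order_trans[OF _ abs_ge_self])
  then show ?thesis
    by (rule Bochner_Integration.integrable_bound[OF i measurable_ot_map[OF Q]])
qed

lemma integrable_inner_ot_map: "Q \<in> pd_mats \<Longrightarrow> integrable P (\<lambda>S. ot_map Q S \<bullet> X)"
  by (intro integrable_inner_left integrable_ot_map)

lemma integral_inner_ot_map: "Q \<in> pd_mats \<Longrightarrow> (\<integral>S. ot_map Q S \<bullet> X \<partial>P) = mean_ot Q \<bullet> X"
  unfolding mean_ot_def by (intro integral_inner_left integrable_ot_map)

text \<open>The expectation of the inequality for the fidelity. Its defect \<open>g\<close> is nonnegative; if the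
  expectation of \<open>g\<close> were zero, \<open>g\<close> would vanish almost surely, in particular at some positive
  definite matrix, which is the equality case of that inequality.\<close>
theorem cost_subgradient:
  assumes Q: "Q \<in> pd_mats" and Q': "Q' \<in> psd_mats"
  shows "cost Q + (mat 1 - mean_ot Q) \<bullet> (Q' - Q) \<le> cost Q'"
    and "Q' \<noteq> Q \<Longrightarrow> cost Q + (mat 1 - mean_ot Q) \<bullet> (Q' - Q) < cost Q'"
proof -
  have Qp: "Q \<in> psd_mats" using Q by (rule pd_imp_psd)
  define g where "g S = ot_map Q S \<bullet> (Q' - Q) + 2 * fidelity Q S - 2 * fidelity Q' S" for S
  have g_eq: "g S = ot_map Q S \<bullet> Q + ot_map Q S \<bullet> Q' - 2 * fidelity Q' S" if "S \<in> psd_mats" for S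
    using fidelity_ot_map[OF Qp that] by (simp add: g_def inner_diff_right)
  have g_nn: "0 \<le> g S" if "S \<in> psd_mats" for S
    using fidelity_subgradient(1)[OF Q Q' that] by (simp add: g_eq that)
  have int_g: "integrable P g" unfolding g_def
    by (intro Bochner_Integration.integrable_diff Bochner_Integration.integrable_add integrable_mult_right
        integrable_inner_ot_map integrable_fidelity Q Q' Qp)
  have "(\<integral>S. g S \<partial>P) = mean_ot Q \<bullet> (Q' - Q) + 2 * mean_fidelity Q - 2 * mean_fidelity Q'"
    unfolding g_def mean_fidelity_def
    by (simp add: integrable_inner_ot_map integrable_fidelity Q Q' Qp integral_inner_ot_map)
  also have "\<dots> = cost Q' - (cost Q + (mat 1 - mean_ot Q) \<bullet> (Q' - Q))"
    by (simp add: cost_eq Qp Q' inner_diff_left inner_diff_right)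
  finally have eq: "(\<integral>S. g S \<partial>P) = cost Q' - (cost Q + (mat 1 - mean_ot Q) \<bullet> (Q' - Q))" .
  have nn: "0 \<le> (\<integral>S. g S \<partial>P)" by (intro integral_nonneg_AE AE_I2 g_nn) (simp add: space_P)
  then show le: "cost Q + (mat 1 - mean_ot Q) \<bullet> (Q' - Q) \<le> cost Q'" using eq by simp
  assume ne: "Q' \<noteq> Q"
  have "(\<integral>S. g S \<partial>P) \<noteq> 0"
  proof
    assume "(\<integral>S. g S \<partial>P) = 0"
    then have "AE S in P. g S = 0"
      using integral_nonneg_eq_0_iff_AE[OF int_g AE_I2] g_nn by (simp add: space_P)
    then have "AE S in P. S \<notin> pd_mats"
    proof (rule AE_mp, intro AE_I2 impI notI)
      fix S assume S: "g S = 0" "S \<in> pd_mats"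
      then have "S \<in> psd_mats" by (simp add: pd_imp_psd)
      then have "2 * fidelity Q' S = ot_map Q S \<bullet> Q + ot_map Q S \<bullet> Q'" using S g_eq by simp
      then show False using fidelity_subgradient(2)[OF Q Q' \<open>S \<in> psd_mats\<close> S(2)] ne by simp
    qed
    moreover have "pd_mats \<in> events" using prob_pd measure_notin_sets by fastforce
    ultimately have "prob pd_mats = 0" using prob_eq_0 by blast
    with prob_pd show False by simp
  qed
  with nn eq show "cost Q + (mat 1 - mean_ot Q) \<bullet> (Q' - Q) < cost Q'" by simp
qed

lemma continuous_on_cost: "continuous_on psd_mats cost"
proof -
  have "continuous_on psd_mats mean_fidelity"
    unfolding continuous_on_sequentially o_def
  proof safe
    fix x :: "nat \<Rightarrow> complex^'n^'n" and a
    assume a: "a \<in> psd_mats" and x: "\<forall>n. x n \<in> psd_mats" and lim: "x \<longlonglongrightarrow> a"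
    have "(\<lambda>k. mat 1 \<bullet> x k) \<longlonglongrightarrow> mat 1 \<bullet> a" by (intro tendsto_intros lim)
    then obtain r where r: "norm (mat 1 \<bullet> x k) \<le> r" for k
      using convergent_imp_Bseq[of "\<lambda>k. mat 1 \<bullet> x k"] by (auto simp: convergent_def Bseq_def)
    show "(\<lambda>k. mean_fidelity (x k)) \<longlonglongrightarrow> mean_fidelity a"
      unfolding mean_fidelity_def
    proof (rule integral_dominated_convergence[where w = "fidelity_majorant r"])
      show "fidelity a \<in> borel_measurable P" "fidelity (x k) \<in> borel_measurable P" for k
        using a x by (simp_all add: measurable_fidelity)
      show "integrable P (fidelity_majorant r)" by (rule integrable_fidelity_majorant)
      show "AE S in P. norm (fidelity (x k) S) \<le> fidelity_majorant r S" for k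
        using x r[of k] by (intro norm_fidelity_le) auto
      show "AE S in P. (\<lambda>k. fidelity (x k) S) \<longlonglongrightarrow> fidelity a S"
      proof (rule AE_I2)
        fix S assume "S \<in> space P"
        then have "continuous_on psd_mats (\<lambda>Q. fidelity Q S)"
          by (intro continuous_on_fidelity continuous_on_id continuous_on_const) (auto simp: space_P)
        then show "(\<lambda>k. fidelity (x k) S) \<longlonglongrightarrow> fidelity a S"
          by (rule continuous_on_tendsto_compose[OF _ lim a]) (simp add: x)
      qed
    qed
  qed
  then have "continuous_on psd_mats (\<lambda>Q. mat 1 \<bullet> Q + mean_trace - 2 * mean_fidelity Q)"
    by (intro continuous_intros)
  then show ?thesis by (simp add: cost_eq cong: continuous_on_cong)
qed

lemma mean_ot_tendsto:
  fixes Q :: "nat \<Rightarrow> complex^'n^'n"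
  assumes c: "c > 0" "\<And>k. Q k - c *\<^sub>R mat 1 \<in> psd_mats" and lim: "Q \<longlonglongrightarrow> Q0" and Q0: "Q0 \<in> pd_mats"
  shows "(\<lambda>k. mean_ot (Q k)) \<longlonglongrightarrow> mean_ot Q0"
proof -
  have "(\<lambda>k. mat 1 \<bullet> Q k) \<longlonglongrightarrow> mat 1 \<bullet> Q0" by (intro tendsto_intros lim)
  then obtain r where r: "norm (mat 1 \<bullet> Q k) \<le> r" for k
    using convergent_imp_Bseq[of "\<lambda>k. mat 1 \<bullet> Q k"] by (auto simp: convergent_def Bseq_def)
  show ?thesis
    unfolding mean_ot_def
  proof (rule integral_dominated_convergence[where w = "\<lambda>S. fidelity_majorant r S / c"])
    show "ot_map Q0 \<in> borel_measurable P" by (intro measurable_ot_map Q0)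
    show "ot_map (Q k) \<in> borel_measurable P" for k
      by (intro measurable_ot_map pd_if_lower_bound[OF c])
    show "integrable P (\<lambda>S. fidelity_majorant r S / c)" by (intro integrable_divide integrable_fidelity_majorant)
    show "AE S in P. norm (ot_map (Q k) S) \<le> fidelity_majorant r S / c" for k
      using r[of k] by (intro norm_ot_map_le_majorant c) auto
    show "AE S in P. (\<lambda>k. ot_map (Q k) S) \<longlonglongrightarrow> ot_map Q0 S"
      by (intro AE_I2 tendsto_ot_map[OF c lim Q0]) (simp add: space_P)
  qed
qed

lemma cost_coercive:
  assumes Q: "Q \<in> psd_mats"
  shows "(mat 1 \<bullet> Q) / 2 + (1 - 2 * (norm (mat 1 :: complex^'n^'n))\<^sup>2) * mean_trace \<le> cost Q"
proof -
  have "mean_fidelity Q \<le> (\<integral>S. fidelity_majorant (mat 1 \<bullet> Q) S \<partial>P)"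
    unfolding mean_fidelity_def
    by (intro integral_mono integrable_fidelity integrable_fidelity_majorant Q fidelity_le_majorant) (auto simp: space_P)
  also have "\<dots> = (mat 1 \<bullet> Q) / 4 + (norm (mat 1 :: complex^'n^'n))\<^sup>2 * mean_trace"
    unfolding fidelity_majorant_def mean_trace_def by (simp add: integrable_trace prob_space)
  finally show ?thesis by (simp add: cost_eq Q algebra_simps)
qed

text \<open>By coercivity, points of trace above \<open>r\<close> cost more than \<open>Q1\<close>, and the remaining ones form a
  compact set.\<close>
lemma cost_minimizer_exists:
  assumes A: "closed A" and Q1: "Q1 \<in> psd_mats \<inter> A"
  obtains Q where "Q \<in> psd_mats \<inter> A" "\<And>Q'. Q' \<in> psd_mats \<inter> A \<Longrightarrow> cost Q \<le> cost Q'"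
proof -
  define e where "e = (1 - 2 * (norm (mat 1 :: complex^'n^'n))\<^sup>2) * mean_trace"
  define r where "r = 2 * (cost Q1 - e)"
  define K where "K = (psd_mats \<inter> A) \<inter> {Q. mat 1 \<bullet> Q \<le> r}"
  have sub: "K \<subseteq> psd_mats" by (auto simp: K_def)
  have low: "(mat 1 \<bullet> Q) / 2 + e \<le> cost Q" if "Q \<in> psd_mats" for Q
    using cost_coercive[OF that] by (simp add: e_def)
  have "bounded K"
    unfolding bounded_iff
    by (rule exI[of _ r]) (use psd_norm_le_trace in \<open>force simp: K_def\<close>)
  moreover have "closed K"
    unfolding K_def by (intro closed_Int closed_psd A closed_Collect_le continuous_intros)
  ultimately have "compact K" by (simp add: compact_eq_bounded_closed)
  moreover have "Q1 \<in> K" using Q1 low[of Q1] by (auto simp: K_def r_def)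
  ultimately obtain Q where Q: "Q \<in> K" "\<And>Q'. Q' \<in> K \<Longrightarrow> cost Q \<le> cost Q'"
    using continuous_attains_inf[of K cost] continuous_on_subset[OF continuous_on_cost sub] by blast
  show thesis
  proof (rule that)
    show "Q \<in> psd_mats \<inter> A" using Q by (auto simp: K_def)
    fix Q' assume Q': "Q' \<in> psd_mats \<inter> A"
    show "cost Q \<le> cost Q'"
    proof (cases "Q' \<in> K")
      case False
      then have "mat 1 \<bullet> Q' > r" using Q' by (auto simp: K_def)
      then have "cost Q1 \<le> cost Q'" using low[of Q'] Q' by (simp add: r_def)
      with Q(2)[OF \<open>Q1 \<in> K\<close>] show ?thesis by simp
    qed (use Q in auto)
  qed
qed

text \<open>The subgradient is taken at the perturbed point, which is positive definite, and not at \<open>Q\<close>,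
  which may be singular.\<close>
lemma minimizer_variational_inequality:
  assumes Q: "Q \<in> psd_mats" and t: "t > 0" and pd: "Q + t *\<^sub>R D \<in> pd_mats"
    and le: "cost Q \<le> cost (Q + t *\<^sub>R D)"
  shows "mean_ot (Q + t *\<^sub>R D) \<bullet> D \<le> mat 1 \<bullet> D"
proof -
  have "0 \<le> (mat 1 - mean_ot (Q + t *\<^sub>R D)) \<bullet> (t *\<^sub>R D)"
    using cost_subgradient(1)[OF pd Q] le by simp
  then show ?thesis using t by (simp add: inner_diff_left zero_le_mult_iff)
qed

text \<open>The positive definite cone is the increasing union of the closed sets \<open>{S. S \<ge> I/k}\<close>, so one of
  these has positive probability.\<close>
lemma exists_prob_lower_bound:
  obtains s E where "s > 0" "E \<in> events" "prob E > 0" "\<And>S. S \<in> E \<Longrightarrow> S - s *\<^sub>R mat 1 \<in> psd_mats"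
proof -
  define E where "E k = psd_mats \<inter> {S :: complex^'n^'n. S - (1 / real (Suc k)) *\<^sub>R mat 1 \<in> psd_mats}" for k
  have ev: "E k \<in> events" for k
  proof -
    have "closed ((\<lambda>S :: complex^'n^'n. S - (1 / real (Suc k)) *\<^sub>R mat 1) -` psd_mats)"
      by (intro closed_vimage closed_psd continuous_intros)
    then have "{S :: complex^'n^'n. S - (1 / real (Suc k)) *\<^sub>R mat 1 \<in> psd_mats} \<in> sets borel"
      by (simp add: vimage_def)
    then show ?thesis unfolding sets_P sets_restrict_space E_def by auto
  qed
  have "\<exists>k. prob (E k) > 0"
  proof (rule ccontr)
    assume "\<nexists>k. prob (E k) > 0"
    then have "prob (E k) = 0" for k by (metis measure_nonneg order_le_less)
    then have "AE S in P. S \<notin> E k" for k using prob_eq_0[OF ev] by blast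
    then have "AE S in P. \<forall>k. S \<notin> E k" by (simp add: AE_all_countable)
    then have "AE S in P. S \<notin> pd_mats"
    proof (rule AE_mp, intro AE_I2 impI notI)
      fix S assume S: "\<forall>k. S \<notin> E k" "S \<in> pd_mats"
      obtain c where c: "c > 0" "S - c *\<^sub>R mat 1 \<in> psd_mats" using pd_lower_bound[OF S(2)] .
      obtain k where k: "1 / real (Suc k) < c" using c(1) nat_approx_posE by metis
      have "(S - c *\<^sub>R mat 1) + (c - 1 / real (Suc k)) *\<^sub>R mat 1 \<in> psd_mats"
        by (intro psd_add psd_scaleR psd_one c) (use k in simp)
      then have "S - (1 / real (Suc k)) *\<^sub>R mat 1 \<in> psd_mats" by (simp add: scaleR_diff_left)
      then have "S \<in> E k" using S(2) by (simp add: E_def pd_imp_psd)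
      with S(1) show False by blast
    qed
    moreover have "pd_mats \<in> events" using prob_pd measure_notin_sets by fastforce
    ultimately have "prob pd_mats = 0" using prob_eq_0 by blast
    with prob_pd show False by simp
  qed
  then obtain k where "prob (E k) > 0" by blast
  then show thesis by (intro that[of "1 / real (Suc k)" "E k"]) (use ev in \<open>auto simp: E_def\<close>)
qed

text \<open>For \<open>Q\<^sub>t = Q + t (Q\<^sub>1 - Q)\<close> the variational inequality bounds \<open>\<bbbE> \<langle>T\<^sub>t, Q\<^sub>1\<rangle> - \<bbbE> \<langle>T\<^sub>t, Q\<rangle>\<close> from above. The
  second term stays bounded, since \<open>\<langle>T\<^sub>t, Q\<rangle> \<le> 2 \<langle>T\<^sub>t, Q\<^sub>t\<rangle> = 2 F(Q\<^sub>t, S)\<close> for \<open>t \<le> 1/2\<close>, while the first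
  is at least \<open>c \<bbbE> tr T\<^sub>t\<close>, which exceeds any bound for small \<open>t\<close> if \<open>Q\<close> is singular.\<close>
lemma minimizer_pd:
  assumes Q: "Q \<in> psd_mats" and Q1: "Q1 \<in> pd_mats"
    and min: "\<And>t. \<lbrakk>0 < t; t \<le> 1\<rbrakk> \<Longrightarrow> cost Q \<le> cost (Q + t *\<^sub>R (Q1 - Q))"
  shows "Q \<in> pd_mats"
proof (rule ccontr)
  assume npd: "Q \<notin> pd_mats"
  obtain c where c: "c > 0" "Q1 - c *\<^sub>R mat 1 \<in> psd_mats" using pd_lower_bound[OF Q1] .
  obtain s E where s: "s > 0" and E: "E \<in> events" "prob E > 0"
    and sE: "\<And>S. S \<in> E \<Longrightarrow> S - s *\<^sub>R mat 1 \<in> psd_mats"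
    using exists_prob_lower_bound by blast
  let ?D = "Q1 - Q"
  obtain b where b: "b > 0" "\<And>t S. \<lbrakk>t > 0; Q + t *\<^sub>R ?D \<in> pd_mats; S - s *\<^sub>R mat 1 \<in> psd_mats\<rbrakk>
      \<Longrightarrow> b \<le> t * (mat 1 \<bullet> ot_map (Q + t *\<^sub>R ?D) S)\<^sup>2"
    using ot_map_blows_up[OF Q npd s] by blast
  define r where "r = mat 1 \<bullet> Q + mat 1 \<bullet> Q1"
  define B where "B = mat 1 \<bullet> ?D + 2 * (\<integral>S. fidelity_majorant r S \<partial>P)"
  \<comment> \<open>The level that \<open>tr T\<^sub>t\<close> has to reach on \<open>E\<close> for a contradiction; \<open>t\<close> is chosen for this level.\<close>
  define m where "m = (\<bar>B\<bar> + 1) / (c * prob E)"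
  have m: "m > 0" using c E by (auto simp: m_def intro!: divide_pos_pos)
  define t where "t = min (1/2) (b / m\<^sup>2)"
  have t: "0 < t" "t \<le> 1/2" "t * m\<^sup>2 \<le> b"
  proof -
    show "0 < t" using b(1) m by (simp add: t_def)
    show "t \<le> 1/2" unfolding t_def by (rule min.cobounded1)
    have "t * m\<^sup>2 \<le> (b / m\<^sup>2) * m\<^sup>2" by (intro mult_right_mono) (simp_all add: t_def)
    then show "t * m\<^sup>2 \<le> b" using m by simp
  qed
  let ?Q = "Q + t *\<^sub>R ?D"
  have pd: "?Q \<in> pd_mats" using pd_segment[OF Q Q1] t by simp
  have psd: "?Q \<in> psd_mats" using pd by (rule pd_imp_psd)
  have Q1p: "Q1 \<in> psd_mats" using Q1 by (rule pd_imp_psd)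
  have "mat 1 \<bullet> ?Q = (1 - t) * (mat 1 \<bullet> Q) + t * (mat 1 \<bullet> Q1)"
    by (simp add: inner_add_right inner_diff_right algebra_simps)
  also have "\<dots> \<le> r" unfolding r_def
    using t trace_psd_nonneg[OF Q] trace_psd_nonneg[OF Q1p]
    by (intro add_mono mult_left_le_one_le) auto
  finally have tr: "mat 1 \<bullet> ?Q \<le> r" .
  have ot: "ot_map ?Q S \<in> psd_mats" if "S \<in> psd_mats" for S using ot_map_psd[OF psd that] .
  have lower: "c * (m * indicator E S) - 2 * fidelity_majorant r S \<le> ot_map ?Q S \<bullet> ?D" if S: "S \<in> psd_mats" for S
  proof -
    let ?T = "ot_map ?Q S"
    have T: "?T \<in> psd_mats" using ot S .
    have "m * indicator E S \<le> mat 1 \<bullet> ?T"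
    proof (cases "S \<in> E")
      case True
      have "t * m\<^sup>2 \<le> t * (mat 1 \<bullet> ?T)\<^sup>2" using t(3) b(2)[OF t(1) pd sE[OF True]] by simp
      then have "m\<^sup>2 \<le> (mat 1 \<bullet> ?T)\<^sup>2" using t by simp
      then have "m \<le> mat 1 \<bullet> ?T" using trace_psd_nonneg[OF T] by (rule power2_le_imp_le)
      then show ?thesis using True by simp
    qed (simp add: trace_psd_nonneg[OF T])
    then have "c * (m * indicator E S) \<le> c * (mat 1 \<bullet> ?T)" using c by simp
    also have "\<dots> \<le> ?T \<bullet> Q1" by (rule psd_inner_lower_bound[OF c(2) T])
    finally have 1: "c * (m * indicator E S) \<le> ?T \<bullet> Q1" .
    have nn: "0 \<le> ?T \<bullet> Q" "0 \<le> ?T \<bullet> Q1" using T Q Q1p by (simp_all add: psd_inner_nonneg)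
    have "(1/2) * (?T \<bullet> Q) \<le> (1 - t) * (?T \<bullet> Q)"
      using nn t by (intro mult_right_mono) auto
    also have "\<dots> \<le> (1 - t) * (?T \<bullet> Q) + t * (?T \<bullet> Q1)"
      using nn t by simp
    also have "\<dots> = ?T \<bullet> ?Q" by (simp add: inner_add_right inner_diff_right algebra_simps)
    also have "\<dots> \<le> fidelity_majorant r S"
      using fidelity_le_majorant[OF psd S tr] by (simp add: fidelity_ot_map[OF psd S])
    finally show ?thesis using 1 by (simp add: inner_diff_right)
  qed
  have "c * (m * prob E) - 2 * (\<integral>S. fidelity_majorant r S \<partial>P) = (\<integral>S. c * (m * indicator E S) - 2 * fidelity_majorant r S \<partial>P)"
    using E integrable_fidelity_majorant by (simp add: emeasure_eq_measure)
  also have "\<dots> \<le> (\<integral>S. ot_map ?Q S \<bullet> ?D \<partial>P)"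
    by (intro integral_mono integrable_inner_ot_map pd lower Bochner_Integration.integrable_diff integrable_mult_right
        integrable_fidelity_majorant) (use E in \<open>auto simp: space_P emeasure_eq_measure\<close>)
  also have "\<dots> = mean_ot ?Q \<bullet> ?D" by (rule integral_inner_ot_map[OF pd])
  also have "\<dots> \<le> mat 1 \<bullet> ?D"
    using minimizer_variational_inequality[OF Q t(1) pd min] t by simp
  finally have "c * (m * prob E) \<le> B" by (simp add: B_def)
  moreover have "c * (m * prob E) = \<bar>B\<bar> + 1" using c E by (simp add: m_def)
  ultimately show False by linarith
qed

text \<open>The variational inequality along \<open>t \<rightarrow> 0\<close>. On a short segment in the direction \<open>X\<close> all points
  share a lower bound \<open>c I\<close>, so that the mean transport maps converge.\<close>
lemma minimizer_first_order:
  assumes Q: "Q \<in> pd_mats" and X: "mat_adj X = X"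
    and min: "\<And>t. Q + t *\<^sub>R X \<in> psd_mats \<Longrightarrow> cost Q \<le> cost (Q + t *\<^sub>R X)"
  shows "mean_ot Q \<bullet> X \<le> mat 1 \<bullet> X"
proof -
  obtain c \<delta> where c: "c > 0" "\<delta> > 0" "\<And>t. \<lbrakk>0 \<le> t; t \<le> \<delta>\<rbrakk> \<Longrightarrow> Q + t *\<^sub>R X - c *\<^sub>R mat 1 \<in> psd_mats"
    using psd_lower_bound_on_direction[OF Q X] by blast
  define t where "t k = \<delta> / real (Suc k)" for k
  have t: "0 < t k" "t k \<le> \<delta>" for k using c by (auto simp: t_def field_simps)
  have low: "Q + t k *\<^sub>R X - c *\<^sub>R mat 1 \<in> psd_mats" for k using t[of k] c(3)[of "t k"] by simp
  have "t \<longlonglongrightarrow> 0" unfolding t_def using LIMSEQ_Suc[OF lim_const_over_n[of \<delta>]] by simp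
  then have "(\<lambda>k. Q + t k *\<^sub>R X) \<longlonglongrightarrow> Q + 0 *\<^sub>R X" by (intro tendsto_intros)
  then have "(\<lambda>k. mean_ot (Q + t k *\<^sub>R X)) \<longlonglongrightarrow> mean_ot Q"
    by (intro mean_ot_tendsto[OF c(1) low _ Q]) simp
  then have "(\<lambda>k. mean_ot (Q + t k *\<^sub>R X) \<bullet> X) \<longlonglongrightarrow> mean_ot Q \<bullet> X" by (intro tendsto_intros)
  moreover have "mean_ot (Q + t k *\<^sub>R X) \<bullet> X \<le> mat 1 \<bullet> X" for k
  proof (rule minimizer_variational_inequality[OF pd_imp_psd[OF Q] t(1)])
    show "Q + t k *\<^sub>R X \<in> pd_mats" using pd_if_lower_bound[OF c(1) low] .
    then show "cost Q \<le> cost (Q + t k *\<^sub>R X)" by (intro min pd_imp_psd)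
  qed
  ultimately show ?thesis by (intro LIMSEQ_le_const2) auto
qed

end

section \<open>The projected first-order equation\<close>

text \<open>Reduces equality of projections to equality of inner products with the elements of \<open>M\<close>; most of
  the proof shows that \<open>orth_proj\<close>, a definite description, is the orthogonal projection.\<close>
lemma orth_proj_eq_iff:
  fixes M :: "'a::euclidean_space set"
  assumes M: "subspace M"
  shows "orth_proj M X = orth_proj M Y \<longleftrightarrow> (\<forall>Z\<in>M. X \<bullet> Z = Y \<bullet> Z)"
proof -
  have ex: "\<exists>Y. Y \<in> M \<and> X - Y \<in> orthogonal_comp M" for X
  proof -
    obtain y z where "y \<in> span M" "\<And>w. w \<in> span M \<Longrightarrow> orthogonal z w" "X = y + z"
      using orthogonal_subspace_decomp_exists[of M X] by blast
    moreover from M have "span M = M" by (simp only: span_eq_iff)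
    ultimately show ?thesis by (intro exI[of _ y]) (auto simp: orthogonal_comp_def orthogonal_commute)
  qed
  have uniq: "Y = Z" if "Y \<in> M" "Z \<in> M" "X - Y \<in> orthogonal_comp M" "X - Z \<in> orthogonal_comp M" for X Y Z
  proof -
    have "Y - Z \<in> M" using that M by (simp add: subspace_diff)
    then have "(Y - Z) \<bullet> (X - Z) = 0" "(Y - Z) \<bullet> (X - Y) = 0" using that by (auto simp: orthogonal_comp_def orthogonal_def)
    then have "(Y - Z) \<bullet> (Y - Z) = 0" by (simp add: inner_diff_right)
    then show ?thesis by simp
  qed
  have p: "orth_proj M X \<in> M" "X - orth_proj M X \<in> orthogonal_comp M" for X
  proof -
    have "\<exists>!Y. Y \<in> M \<and> X - Y \<in> orthogonal_comp M" using ex[of X] uniq by blast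
    from theI'[OF this] show "orth_proj M X \<in> M" "X - orth_proj M X \<in> orthogonal_comp M"
      by (simp_all add: orth_proj_def)
  qed
  have oc: "W \<in> orthogonal_comp M \<longleftrightarrow> (\<forall>Z\<in>M. W \<bullet> Z = 0)" for W
    by (auto simp: orthogonal_comp_def orthogonal_def inner_commute)
  have in_Z: "X \<bullet> Z = orth_proj M X \<bullet> Z" if "Z \<in> M" for X Z
    using p(2)[of X] that by (simp add: oc inner_diff_left)
  show ?thesis
  proof
    assume "orth_proj M X = orth_proj M Y"
    then show "\<forall>Z\<in>M. X \<bullet> Z = Y \<bullet> Z" by (metis in_Z)
  next
    assume eq: "\<forall>Z\<in>M. X \<bullet> Z = Y \<bullet> Z"
    have "X - orth_proj M Y \<in> orthogonal_comp M"
      using eq in_Z[of _ Y] by (simp add: oc inner_diff_left)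
    then show "orth_proj M X = orth_proj M Y" using uniq p by blast
  qed
qed

theorem theorem2p1:
  fixes P :: "(complex^'n^'n) measure"
    and Q0 :: "complex^'n^'n"
    and M A :: "(complex^'n^'n) set"
  assumes "prob_space P"
    and "sets P = sets (restrict_space borel psd_mats)"
    and "measure P pd_mats > 0"
    and "integrable P (\<lambda>S. Re (trace S))"
    and "Q0 \<in> hermitian_mats"
    and "subspace M" and "M \<subseteq> hermitian_mats"
    and "A = (\<lambda>X. Q0 + X) ` M"
    and "pd_mats \<inter> A \<noteq> {}"
  shows "\<exists>Qs. {Q. is_arg_min (\<lambda>Q. \<integral>S. bw_dist_sq Q S \<partial>P) (\<lambda>Q. Q \<in> psd_mats \<inter> A) Q} = {Qs}
    \<and> Qs \<in> pd_mats
    \<and> {Q \<in> pd_mats \<inter> A. orth_proj M (\<integral>S. ot_map Q S \<partial>P) = orth_proj M (mat 1)} = {Qs}"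
proof -
  interpret psd_law P
    using assms by (intro psd_law.intro psd_law_axioms.intro) (simp_all add: Re_trace_eq_inner)
  have A_diff: "Q' - Q \<in> M" if "Q \<in> A" "Q' \<in> A" for Q Q'
    using that assms(6,8) subspace_diff by auto
  have A_add: "Q + X \<in> A" if "Q \<in> A" "X \<in> M" for Q X
    using that assms(6,8) by (auto simp: add.assoc subspace_add)
  have "closed A" unfolding assms(8) using assms(6) by (intro closed_translation closed_subspace)
  obtain Q1 where Q1: "Q1 \<in> pd_mats" "Q1 \<in> A" using assms(9) by blast
  then have "Q1 \<in> psd_mats \<inter> A" by (simp add: pd_imp_psd)
  then obtain Q where Q: "Q \<in> psd_mats" "Q \<in> A"
    and min: "\<And>Q'. Q' \<in> psd_mats \<inter> A \<Longrightarrow> cost Q \<le> cost Q'"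
    using cost_minimizer_exists[OF \<open>closed A\<close>] by blast
  have Qpd: "Q \<in> pd_mats"
  proof (rule minimizer_pd[OF Q(1) Q1(1)])
    fix t :: real assume "0 < t" "t \<le> 1"
    then have "Q + t *\<^sub>R (Q1 - Q) \<in> psd_mats" by (intro pd_imp_psd pd_segment Q Q1)
    moreover have "Q + t *\<^sub>R (Q1 - Q) \<in> A"
      using assms(6) by (intro A_add Q subspace_scale A_diff Q1)
    ultimately show "cost Q \<le> cost (Q + t *\<^sub>R (Q1 - Q))" by (intro min) simp
  qed
  have first_order: "mean_ot Q \<bullet> X \<le> mat 1 \<bullet> X" if "X \<in> M" for X
  proof (rule minimizer_first_order[OF Qpd])
    show "mat_adj X = X" using that assms(7) by (auto simp: hermitian_mats_def)
    show "cost Q \<le> cost (Q + t *\<^sub>R X)" if "Q + t *\<^sub>R X \<in> psd_mats" for t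
      using that A_add[OF Q(2) subspace_scale[OF assms(6) \<open>X \<in> M\<close>]] by (intro min) simp
  qed
  have critical: "mean_ot Q \<bullet> X = mat 1 \<bullet> X" if "X \<in> M" for X
    using first_order[OF that] first_order[of "- X"] that subspace_neg[OF assms(6)] by simp
  have strict: "cost Q2 < cost Q'"
    if Q2: "Q2 \<in> pd_mats" "Q2 \<in> A" "\<forall>Z\<in>M. mean_ot Q2 \<bullet> Z = mat 1 \<bullet> Z"
      and Q': "Q' \<in> psd_mats" "Q' \<in> A" "Q' \<noteq> Q2" for Q2 Q'
    using cost_subgradient(2)[OF Q2(1) Q'(1,3)] Q2(3) A_diff[OF Q2(2) Q'(2)] by (simp add: inner_diff_left)
  have unique_argmin: "Q' = Q" if "Q' \<in> psd_mats" "Q' \<in> A" "cost Q' \<le> cost Q" for Q'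
    using strict[OF Qpd Q(2) _ that(1,2)] critical that(3) by force
  have "{Q. is_arg_min cost (\<lambda>Q. Q \<in> psd_mats \<inter> A) Q} = {Q}"
    using Q min unique_argmin by (auto simp: is_arg_min_linorder)
  moreover have "{Q \<in> pd_mats \<inter> A. orth_proj M (mean_ot Q) = orth_proj M (mat 1)} = {Q}"
  proof -
    have "Q' = Q" if "Q' \<in> pd_mats" "Q' \<in> A" "\<forall>Z\<in>M. mean_ot Q' \<bullet> Z = mat 1 \<bullet> Z" for Q'
      using strict[OF that Q] min[of Q'] that pd_imp_psd by force
    then show ?thesis unfolding orth_proj_eq_iff[OF assms(6)] using Qpd Q(2) critical by blast
  qed
  ultimately show ?thesis
    using Qpd by (intro exI[of _ Q]) (simp add: cost_def[abs_def] mean_ot_def)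
qed

end
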